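(* Let $f:\mathbb{R}\to\mathbb{R}$ be a restriction of an entire function, and let $\mathcal{K}^n$ be the chromatic derivatives associated with the Legendre polynomials. Then the following are equivalent: (1) $\sum_{n=0}^{\infty}\mathcal{K}^n[f](0)^2<\infty$; (2) for all $t\in\mathbb{R}$ the sum $\sum_{n=0}^{\infty}\mathcal{K}^n[f](t)^2$ converges, and its value is constant, i.e. independent of $t\in\mathbb{R}$; (3) $f\in\mathbf{BL}(\pi)$.
   Context: $\mathbf{BL}(\pi)$ is the Hilbert space of real valued continuous $L^2(\mathbb{R})$ functions whose Fourier transform is supported in $[-\pi,\pi]$, with the usual scalar product. Let $p^L_n(\omega)=\sqrt{2n+1}\,P_n(\omega/\pi)$, where $P_n$ are the Legendre polynomials, so that $\frac{1}{2\pi}\int_{-\pi}^{\pi}p^L_n(\omega)p^L_m(\omega)\,d\omega=\delta(m-n)$, where $\delta(0)=1$ and $\delta(k)=0$ for $k\ne0$. The chromatic derivatives associated with the Legendre polynomials are the differential operators (with real coefficients) $\mathcal{K}^n=\mathrm{i}^n p^L_n\left(-\mathrm{i}\frac{d}{dt}\right)$, i.e. $\omega^k$ in $p_n^L(\omega)$ is replaced by $(-\mathrm{i})^k\,d^k/dt^k$ and the result is multiplied by $\mathrm{i}^n$; $\mathcal{K}^n[f](t)$ is the value at $t$ of $\mathcal{K}^n$ applied to $f$. *)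

theory Defs
  imports
    "HOL-Complex_Analysis.Complex_Analysis"
    "HOL-Computational_Algebra.Computational_Algebra"
begin

text \<open>Legendre polynomials by Rodrigues' formula
  \<open>P\<^sub>n(x) = 1 / (2\<^sup>n n!) \<cdot> d\<^sup>n/dx\<^sup>n (x\<^sup>2 - 1)\<^sup>n\<close>.\<close>

definition legendre :: "nat \<Rightarrow> real poly" where
  "legendre n = smult (1 / (2 ^ n * fact n)) ((pderiv ^^ n) ([:-1, 0, 1:] ^ n))"

definition legendre_pi :: "nat \<Rightarrow> real poly" where
  "legendre_pi n = smult (sqrt (2 * real n + 1)) (legendre n \<circ>\<^sub>p [:0, 1 / pi:])"

text \<open>\<open>chromatic_coeff n k\<close> is the coefficient of \<open>d\<^sup>k/dt\<^sup>k\<close> in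
  \<open>\<i>\<^sup>n p\<^sub>n(-\<i> d/dt)\<close>. By the parity of the Legendre polynomials it is a real number, so that
  taking the real part loses nothing: see \<open>chromatic_coeff_complex\<close> below.\<close>

definition chromatic_coeff :: "nat \<Rightarrow> nat \<Rightarrow> real" where
  "chromatic_coeff n k = Re (\<i> ^ n * complex_of_real (coeff (legendre_pi n) k) * (- \<i>) ^ k)"

definition chromatic_deriv :: "nat \<Rightarrow> (real \<Rightarrow> real) \<Rightarrow> real \<Rightarrow> real" where
  "chromatic_deriv n f t =
     (\<Sum>k\<le>degree (legendre_pi n). chromatic_coeff n k * (deriv ^^ k) f t)"

lemma coeff_pderiv_funpow_eq_0:
  fixes p :: "real poly"
  assumes "coeff p (k + n) = 0"
  shows "coeff ((pderiv ^^ n) p) k = 0"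
  using assms by (induction n arbitrary: k) (simp_all add: coeff_pderiv)

lemma coeff_rodrigues_odd:
  assumes "odd k"
  shows "coeff ([:-1, 0, 1:] ^ n :: real poly) k = 0"
  using assms
proof (induction n arbitrary: k)
  case 0
  then show ?case by (cases k) auto
next
  case (Suc n)
  then show ?case
    by (cases k; cases "k - 1") (auto simp: coeff_pCons)
qed

lemma coeff_legendre_pi_eq_0:
  assumes "odd (n + k)"
  shows "coeff (legendre_pi n) k = 0"
proof -
  have "coeff ([:-1, 0, 1:] ^ n :: real poly) (k + n) = 0"
    using assms by (intro coeff_rodrigues_odd) (simp add: add.commute)
  then show ?thesis
    by (simp add: legendre_pi_def legendre_def coeff_pcompose_linear coeff_pderiv_funpow_eq_0)
qed

lemma chromatic_coeff_complex:
  "complex_of_real (chromatic_coeff n k) =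
     \<i> ^ n * complex_of_real (coeff (legendre_pi n) k) * (- \<i>) ^ k"
proof (cases "even (n + k)")
  case True
  then obtain m where m: "n + k = 2 * m" by (elim evenE)
  have "\<i> ^ n * (- \<i>) ^ k = (-1) ^ k * \<i> ^ (n + k)"
    by (simp add: power_add power_minus[of \<i>])
  also have "\<dots> = (-1) ^ k * (-1) ^ m"
    by (simp add: m power_mult)
  finally have eq: "\<i> ^ n * (- \<i>) ^ k = complex_of_real ((-1) ^ k * (-1) ^ m)"
    by simp
  have "\<i> ^ n * complex_of_real (coeff (legendre_pi n) k) * (- \<i>) ^ k
      = complex_of_real (coeff (legendre_pi n) k) * (\<i> ^ n * (- \<i>) ^ k)"
    by (simp only: mult_ac)
  also have "\<dots> = complex_of_real (coeff (legendre_pi n) k * ((-1) ^ k * (-1) ^ m))"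
    by (simp only: eq of_real_mult)
  finally show ?thesis
    by (simp only: chromatic_coeff_def Re_complex_of_real)
next
  case False
  then show ?thesis by (simp add: chromatic_coeff_def coeff_legendre_pi_eq_0)
qed

definition square_integrable :: "(real \<Rightarrow> 'a::{banach,second_countable_topology}) \<Rightarrow> bool" where
  "square_integrable f \<longleftrightarrow>
     f \<in> borel_measurable lborel \<and> integrable lborel (\<lambda>x. (norm (f x))\<^sup>2)"

text \<open>\<open>L2_fourier f g\<close>: the \<open>L\<^sup>2\<close> function \<open>g\<close> represents the (Plancherel) Fourier transform of
  \<open>f\<close>, that is, \<open>g(\<omega>) = \<integral> f(t) e\<^bsup>-\<i>\<omega>t\<^esup> dt\<close> with the integral understood as the limit of its
  truncations to \<open>[-N, N]\<close> in the \<open>L\<^sup>2\<close> norm. It determines \<open>g\<close> up to null sets. The norm is taken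
  with the nonnegative integral, as the Bochner integral is \<open>0\<close> on non-integrable functions.\<close>

definition L2_fourier :: "(real \<Rightarrow> complex) \<Rightarrow> (real \<Rightarrow> complex) \<Rightarrow> bool" where
  "L2_fourier f g \<longleftrightarrow>
     square_integrable f \<and> square_integrable g \<and>
     ((\<lambda>N::real. \<integral>\<^sup>+\<omega>.
          ennreal ((norm (g \<omega> - (LINT t:{-N..N}|lborel. f t * exp (- \<i> * \<omega> * t)))) \<^sup>2) \<partial>lborel)
        \<longlongrightarrow> 0) at_top"

text \<open>As the Fourier transform is a class of functions modulo null sets, having its support in
  \<open>[-\<sigma>, \<sigma>]\<close> means vanishing almost everywhere outside \<open>[-\<sigma>, \<sigma>]\<close>.\<close>

definition BL :: "real \<Rightarrow> (real \<Rightarrow> real) set" where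
  "BL \<sigma> = {f. continuous_on UNIV f \<and> square_integrable f \<and>
     (\<exists>g. L2_fourier (\<lambda>t. complex_of_real (f t)) g \<and>
          (AE \<omega> in lborel. \<omega> \<notin> {-\<sigma>..\<sigma>} \<longrightarrow> g \<omega> = 0))}"

end

theory Submission
  imports Defs "HOL-Probability.Characteristic_Functions"
begin

text \<open>
  The idea is that, up to unimodular factors, the numbers \<open>K\<^sup>n[f](t)\<close> are Legendre coefficients of a
  function on \<open>[-\<pi>, \<pi>]\<close> which depends on \<open>t\<close> only by a factor of modulus one. If
  \<open>f(t) = 1/(2\<pi>) \<integral> \<phi>(\<omega>) e\<^bsup>\<i>\<omega>t\<^esup> d\<omega>\<close> with \<open>\<phi>\<close> square integrable and
  supported in \<open>[-\<pi>, \<pi>]\<close>, then differentiation under the integral turns the operator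
  \<open>\<i>\<^sup>n p\<^sub>n(-\<i> d/dt)\<close> into multiplication by \<open>\<i>\<^sup>n p\<^sub>n(\<omega>)\<close>, so \<open>K\<^sup>n[f](t)\<close> is \<open>\<i>\<^sup>n\<close> times the \<open>n\<close>-th Legendre
  coefficient of \<open>\<phi>(\<omega>) e\<^bsup>\<i>\<omega>t\<^esup>\<close> (\<open>chromatic_deriv_inv_ft\<close>). By Parseval's identity for the Legendre
  basis the sum of their squares is a constant times the squared norm of \<open>\<phi>(\<omega>) e\<^bsup>\<i>\<omega>t\<^esup>\<close>, and the
  unimodular factor \<open>e\<^bsup>\<i>\<omega>t\<^esup>\<close> does not change it: the sum does not depend on \<open>t\<close> (\<open>chromatic_energy\<close>). What remains is to obtain such a
  representation of \<open>f\<close> from square summability at \<open>0\<close> as well as from band-limitedness, and to see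
  that it implies the latter.

  If the \<open>K\<^sup>n[f](0)\<close> are square summable, the Riesz--Fischer theorem yields a \<open>\<phi>\<close> with the corresponding
  Legendre coefficients. Since
  \<open>K\<^sup>n\<close> has order exactly \<open>n\<close>, the values \<open>K\<^sup>n[f](0)\<close> determine all derivatives at \<open>0\<close>; hence \<open>f\<close>
  and the integral of \<open>\<phi>\<close> have the same Taylor series, and they agree because \<open>f\<close> extends to an
  entire function (\<open>summable_imp_inv_ft\<close>).

  That this representation is the same thing as \<open>f \<in> BL \<pi>\<close> is the theory of the Fourier transform
  in \<open>L\<^sup>2\<close>, of which only one theorem is needed: for a square-integrable \<open>h\<close> of bounded support the
  integral \<open>\<integral> h(x) e\<^bsup>-\<i>\<omega>x\<^esup> dx\<close> converges and satisfies Plancherel's identity (\<open>plancherel\<close>). It is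
  applied both to \<open>\<phi>\<close> and to truncations of functions of time. The first gives that the inverse
  transform \<open>f\<close> of \<open>\<phi>\<close> is square integrable; with the second, the squared error in recovering \<open>\<phi>\<close> from
  the truncation of \<open>f\<close> to \<open>[-N, N]\<close> is exactly \<open>\<parallel>\<phi>\<parallel>\<^sup>2 - 2\<pi> \<integral>\<^bsub>-N\<^esub>\<^bsup>N\<^esup> \<bar>f\<bar>\<^sup>2\<close>, which tends to \<open>0\<close>
  (\<open>fourier_truncation_error\<close>). Plancherel's identity for truncations also shows that a continuous
  square-integrable function is determined by
  its transform (\<open>L2_fourier_unique\<close>).
\<close>

section \<open>Square-integrable functions on the real line\<close>

text \<open>
  Functions on a bounded interval are extended by zero, so that a single Hilbert space, \<open>L\<^sup>2\<close> of the
  real line, carries both the frequency side and the time side.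
\<close>

definition l2_inner :: "(real \<Rightarrow> complex) \<Rightarrow> (real \<Rightarrow> complex) \<Rightarrow> complex" where
  "l2_inner f g = (LBINT x. f x * cnj (g x))"

definition l2_norm_sq :: "(real \<Rightarrow> complex) \<Rightarrow> real" where
  "l2_norm_sq f = (LBINT x. (norm (f x))\<^sup>2)"

lemma square_integrable_measurable [measurable_dest]:
  "square_integrable f \<Longrightarrow> f \<in> borel_measurable borel"
  by (simp add: square_integrable_def)

lemma square_integrable_integrable_norm_sq:
  "square_integrable f \<Longrightarrow> integrable lborel (\<lambda>x. (norm (f x))\<^sup>2)"
  by (simp add: square_integrable_def)

lemma borel_measurable_cnj [measurable]: "cnj \<in> borel_measurable borel"
  by (intro borel_measurable_continuous_onI continuous_intros)

text \<open>
  Together with its integrated form this replaces the triangle inequality of the \<open>L\<^sup>2\<close> norm: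
  all estimates below can afford the factor \<open>2\<close>, and squares avoid roots and Minkowski's inequality.
\<close>

lemma norm_sum_sq_le:
  fixes a b :: "'a::real_normed_vector"
  shows "(norm (a + b))\<^sup>2 \<le> 2 * (norm a)\<^sup>2 + 2 * (norm b)\<^sup>2"
proof -
  have "(norm (a + b))\<^sup>2 \<le> (norm a + norm b)\<^sup>2"
    by (rule power_mono[OF norm_triangle_ineq norm_ge_zero])
  also have "\<dots> \<le> 2 * (norm a)\<^sup>2 + 2 * (norm b)\<^sup>2"
    using sum_squares_bound[of "norm a" "norm b"] by (simp add: power2_sum)
  finally show ?thesis .
qed

lemma square_integrable_bound:
  fixes f :: "real \<Rightarrow> complex"
  assumes "f \<in> borel_measurable borel" "integrable lborel g" "\<And>x. (norm (f x))\<^sup>2 \<le> g x"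
  shows "square_integrable f"
  unfolding square_integrable_def
proof
  show "integrable lborel (\<lambda>x. (norm (f x))\<^sup>2)"
  proof (rule Bochner_Integration.integrable_bound[OF assms(2)])
    show "(\<lambda>x. (norm (f x))\<^sup>2) \<in> borel_measurable lborel"
      using assms(1) by measurable
    have "norm ((norm (f x))\<^sup>2) \<le> norm (g x)" for x
      using assms(3)[of x] by simp
    then show "AE x in lborel. norm ((norm (f x))\<^sup>2) \<le> norm (g x)"
      by simp
  qed
qed (use assms(1) in simp)

lemma square_integrable_add [intro]:
  fixes f g :: "real \<Rightarrow> complex"
  assumes [measurable]: "square_integrable f" "square_integrable g"
  shows "square_integrable (\<lambda>x. f x + g x)"
  by (rule square_integrable_bound[where g = "\<lambda>x. 2 * (norm (f x))\<^sup>2 + 2 * (norm (g x))\<^sup>2"])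
    (use assms in \<open>auto intro!: norm_sum_sq_le square_integrable_integrable_norm_sq\<close>)

lemma square_integrable_mult_left [intro]:
  fixes f :: "real \<Rightarrow> complex"
  assumes [measurable]: "square_integrable f"
  shows "square_integrable (\<lambda>x. c * f x)"
  by (rule square_integrable_bound[where g = "\<lambda>x. (norm c)\<^sup>2 * (norm (f x))\<^sup>2"])
    (use assms in \<open>auto intro!: square_integrable_integrable_norm_sq simp: norm_mult power_mult_distrib\<close>)

lemma square_integrable_zero [simp]: "square_integrable (\<lambda>x. 0 :: complex)"
  by (simp add: square_integrable_def)

lemma square_integrable_diff [intro]:
  fixes f g :: "real \<Rightarrow> complex"
  assumes "square_integrable f" "square_integrable g"
  shows "square_integrable (\<lambda>x. f x - g x)"
  using square_integrable_add[OF assms(1) square_integrable_mult_left[OF assms(2), of "-1"]] by simp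

lemma square_integrable_sum [intro]:
  fixes f :: "'i \<Rightarrow> real \<Rightarrow> complex"
  assumes "\<And>i. i \<in> A \<Longrightarrow> square_integrable (f i)"
  shows "square_integrable (\<lambda>x. \<Sum>i\<in>A. f i x)"
  using assms by (induction A rule: infinite_finite_induct) auto

lemma square_integrable_mult_bounded:
  fixes f :: "real \<Rightarrow> complex"
  assumes [measurable]: "square_integrable f" "u \<in> borel_measurable borel"
    and "\<And>x. norm (u x) \<le> B"
  shows "square_integrable (\<lambda>x. u x * f x)"
proof (rule square_integrable_bound[where g = "\<lambda>x. B\<^sup>2 * (norm (f x))\<^sup>2"])
  fix x
  have "(norm (u x))\<^sup>2 \<le> B\<^sup>2" using assms(3)[of x] by (intro power_mono) auto
  then show "(norm (u x * f x))\<^sup>2 \<le> B\<^sup>2 * (norm (f x))\<^sup>2"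
    by (auto simp: norm_mult power_mult_distrib intro!: mult_right_mono)
qed (use assms in \<open>auto intro!: square_integrable_integrable_norm_sq\<close>)

lemma square_integrable_cutoff:
  fixes f :: "real \<Rightarrow> complex"
  assumes [measurable]: "square_integrable f" "A \<in> sets borel"
  shows "square_integrable (\<lambda>x. indicator A x *\<^sub>R f x)"
  using square_integrable_mult_bounded[OF assms(1), of "\<lambda>x. of_real (indicator A x)" 1]
  by (simp add: scaleR_conv_of_real indicator_le_1)

lemma square_integrable_bounded_support:
  fixes f :: "real \<Rightarrow> complex"
  assumes [measurable]: "f \<in> borel_measurable borel"
    and "\<And>x. norm (f x) \<le> B" "\<And>x. x \<notin> {a..b} \<Longrightarrow> f x = 0"
  shows "square_integrable f"
proof (rule square_integrable_bound[where g = "\<lambda>x. B\<^sup>2 * indicator {a..b} x"])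
  fix x
  show "(norm (f x))\<^sup>2 \<le> B\<^sup>2 * indicator {a..b} x"
    using assms(2)[of x] assms(3)[of x]  by (auto simp: indicator_def intro!: power_mono)
next
  show "integrable lborel (\<lambda>x. B\<^sup>2 * indicator {a..b} x :: real)"
    by (intro integrable_mult_right integrable_real_indicator)
      (simp_all add: emeasure_lborel_Icc_eq)
qed simp

lemma norm_mult_le_squares:
  fixes a b :: complex
  shows "norm (a * b) \<le> (norm a)\<^sup>2 + (norm b)\<^sup>2"
  using sum_squares_bound[of "norm a" "norm b"] zero_le_power2[of "norm a"] zero_le_power2[of "norm b"]
  unfolding norm_mult by linarith

lemma square_integrable_inner_integrable:
  assumes [measurable]: "square_integrable f" "square_integrable g"
  shows "integrable lborel (\<lambda>x. f x * cnj (g x))"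
proof (rule Bochner_Integration.integrable_bound)
  show "integrable lborel (\<lambda>x. (norm (f x))\<^sup>2 + (norm (g x))\<^sup>2)"
    using assms by (auto intro: square_integrable_integrable_norm_sq)
  have "norm (f x * cnj (g x)) \<le> norm ((norm (f x))\<^sup>2 + (norm (g x))\<^sup>2)" for x
    using norm_mult_le_squares[of "f x" "cnj (g x)"] by simp
  then show "AE x in lborel. norm (f x * cnj (g x)) \<le> norm ((norm (f x))\<^sup>2 + (norm (g x))\<^sup>2)"
    by simp
qed simp

lemma square_integrable_imp_integrable:
  fixes f :: "real \<Rightarrow> complex"
  assumes [measurable]: "square_integrable f" and supp: "\<And>x. x \<notin> {a..b} \<Longrightarrow> f x = 0"
  shows "integrable lborel f"
proof -
  have "integrable lborel (\<lambda>x. f x * cnj (indicator {a..b} x))"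
  proof (rule square_integrable_inner_integrable[OF assms(1)])
    show "square_integrable (indicator {a..b} :: real \<Rightarrow> complex)"
      by (rule square_integrable_bounded_support[where B = 1 and a = a and b = b])
        (auto simp: indicator_def)
  qed
  also have "(\<lambda>x. f x * cnj (indicator {a..b} x)) = f"
    using supp by (auto simp: indicator_def fun_eq_iff)
  finally show ?thesis .
qed

lemma l2_inner_diff_left:
  assumes "square_integrable f" "square_integrable g" "square_integrable h"
  shows "l2_inner (\<lambda>x. f x - g x) h = l2_inner f h - l2_inner g h"
  unfolding l2_inner_def
  using assms by (simp add: left_diff_distrib Bochner_Integration.integral_diff square_integrable_inner_integrable)

lemma l2_inner_add_left:
  assumes "square_integrable f" "square_integrable g" "square_integrable h"
  shows "l2_inner (\<lambda>x. f x + g x) h = l2_inner f h + l2_inner g h"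
  unfolding l2_inner_def
  using assms by (simp add: distrib_right Bochner_Integration.integral_add square_integrable_inner_integrable)

lemma l2_inner_mult_left [simp]: "l2_inner (\<lambda>x. c * f x) h = c * l2_inner f h"
  by (simp add: l2_inner_def mult.assoc)

lemma l2_inner_zero_left [simp]: "l2_inner (\<lambda>x. 0) h = 0"
  by (simp add: l2_inner_def)

lemma l2_inner_sum_left:
  assumes "\<And>i. i \<in> A \<Longrightarrow> square_integrable (f i)" "square_integrable h"
  shows "l2_inner (\<lambda>x. \<Sum>i\<in>A. f i x) h = (\<Sum>i\<in>A. l2_inner (f i) h)"
  using assms
  by (induction A rule: infinite_finite_induct) (simp_all add: l2_inner_add_left square_integrable_sum)

lemma l2_norm_sq_nonneg [simp]: "0 \<le> l2_norm_sq f"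
  by (simp add: l2_norm_sq_def)

lemma l2_norm_sq_mult [simp]: "l2_norm_sq (\<lambda>x. c * f x) = (norm c)\<^sup>2 * l2_norm_sq f"
  by (simp add: l2_norm_sq_def norm_mult power_mult_distrib)

lemma l2_norm_sq_minus_commute: "l2_norm_sq (\<lambda>x. f x - g x) = l2_norm_sq (\<lambda>x. g x - f x)"
  by (simp add: l2_norm_sq_def norm_minus_commute)

lemma l2_norm_sq_add_le:
  assumes "square_integrable f" "square_integrable g"
  shows "l2_norm_sq (\<lambda>x. f x + g x) \<le> 2 * l2_norm_sq f + 2 * l2_norm_sq g"
proof -
  have "l2_norm_sq (\<lambda>x. f x + g x) \<le> (LBINT x. 2 * (norm (f x))\<^sup>2 + 2 * (norm (g x))\<^sup>2)"
    unfolding l2_norm_sq_def using assms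
    by (intro integral_mono norm_sum_sq_le)
      (auto intro!: square_integrable_integrable_norm_sq Bochner_Integration.integrable_add)
  also have "\<dots> = 2 * l2_norm_sq f + 2 * l2_norm_sq g"
    unfolding l2_norm_sq_def using assms
    by (subst Bochner_Integration.integral_add) (auto intro!: square_integrable_integrable_norm_sq)
  finally show ?thesis .
qed

lemma l2_norm_sq_diff:
  assumes [measurable]: "square_integrable f" "square_integrable g"
  shows "l2_norm_sq (\<lambda>x. f x - g x) = l2_norm_sq f - 2 * Re (l2_inner f g) + l2_norm_sq g"
proof -
  have "l2_norm_sq (\<lambda>x. f x - g x) = (LBINT x. (norm (f x))\<^sup>2 - 2 * Re (f x * cnj (g x)) + (norm (g x))\<^sup>2)"
    unfolding l2_norm_sq_def
    by (rule Bochner_Integration.integral_cong) (simp_all only: cmod_power2, simp_all add: power2_eq_square algebra_simps)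
  also have "\<dots> = l2_norm_sq f - (LBINT x. 2 * Re (f x * cnj (g x))) + l2_norm_sq g"
  proof -
    have i: "integrable lborel (\<lambda>x. (norm (f x))\<^sup>2)" "integrable lborel (\<lambda>x. (norm (g x))\<^sup>2)"
      "integrable lborel (\<lambda>x. 2 * Re (f x * cnj (g x)))"
      using assms by (auto intro!: square_integrable_integrable_norm_sq integrable_mult_right integrable_Re
          square_integrable_inner_integrable simp del: times_complex.sel)
    show ?thesis unfolding l2_norm_sq_def
      by (simp only: Bochner_Integration.integral_add[OF Bochner_Integration.integrable_diff[OF i(1,3)] i(2)]
          Bochner_Integration.integral_diff[OF i(1,3)])
  qed
  also have "(LBINT x. 2 * Re (f x * cnj (g x))) = 2 * Re (l2_inner f g)"
    unfolding l2_inner_def integral_mult_right_zero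
    by (subst integral_Re) (use assms in \<open>auto intro: square_integrable_inner_integrable\<close>)
  finally show ?thesis .
qed

lemma nn_integral_norm_sq:
  assumes "square_integrable f"
  shows "(\<integral>\<^sup>+x. ennreal ((norm (f x))\<^sup>2) \<partial>lborel) = ennreal (l2_norm_sq f)"
  unfolding l2_norm_sq_def using assms
  by (intro nn_integral_eq_integral square_integrable_integrable_norm_sq) auto

lemma square_integrableI_nn_integral:
  fixes f :: "real \<Rightarrow> complex"
  assumes [measurable]: "f \<in> borel_measurable borel"
    and "(\<integral>\<^sup>+x. ennreal ((norm (f x))\<^sup>2) \<partial>lborel) = ennreal r" "0 \<le> r"
  shows "square_integrable f" "l2_norm_sq f = r"
proof -
  have "integrable lborel (\<lambda>x. (norm (f x))\<^sup>2)"
    by (rule integrableI_nn_integral_finite[where x = r]) (use assms in auto)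
  then show *: "square_integrable f"
    by (simp add: square_integrable_def)
  show "l2_norm_sq f = r"
    using nn_integral_norm_sq[OF *] assms by simp
qed

section \<open>Orthogonality of the Legendre polynomials\<close>

abbreviation rodrigues_base :: "real poly" where
  "rodrigues_base \<equiv> [:-1, 0, 1:]"

definition poly_integral :: "real poly \<Rightarrow> real" where
  "poly_integral p = (LBINT x. poly p x * indicator {-1..1} x)"

lemma integrable_poly_Icc: "integrable lborel (\<lambda>x. poly p x * indicator {a..b} x)" for p :: "real poly"
proof -
  have "continuous_on {a..b} (poly p)" by (intro continuous_intros)
  from borel_integrable_atLeastAtMost'[OF this] show ?thesis
    by (simp add: set_integrable_def mult.commute)
qed

lemma poly_integral_add: "poly_integral (p + q) = poly_integral p + poly_integral q"
  unfolding poly_integral_def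
  by (simp add: distrib_right Bochner_Integration.integral_add integrable_poly_Icc)

lemma poly_integral_smult [simp]: "poly_integral (smult c p) = c * poly_integral p"
  unfolding poly_integral_def by (simp add: mult.assoc)

lemma poly_integral_pderiv: "poly_integral (pderiv p) = poly p 1 - poly p (-1)"
  unfolding poly_integral_def
  by (rule integral_FTC_Icc_real) (auto intro!: poly_DERIV continuous_intros)

lemma poly_integral_by_parts:
  "poly_integral (pderiv p * q) = poly (p * q) 1 - poly (p * q) (-1) - poly_integral (p * pderiv q)"
proof -
  have "poly_integral (pderiv (p * q)) = poly_integral (p * pderiv q) + poly_integral (pderiv p * q)"
    by (simp add: pderiv_mult poly_integral_add mult.commute)
  then show ?thesis by (simp add: poly_integral_pderiv)
qed

text \<open>
  Each differentiation lowers the order of the zeros of \<open>(x\<^sup>2 - 1)\<^sup>n\<close> at \<open>\<plusminus>1\<close> by one. This makes the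
  boundary terms vanish in the \<open>n\<close>-fold integration by parts of Rodrigues' formula.
\<close>

lemma rodrigues_base_power_dvd:
  "k \<le> n \<Longrightarrow> rodrigues_base ^ (n - k) dvd (pderiv ^^ k) (rodrigues_base ^ n)"
proof (induction k)
  case (Suc k)
  then obtain s where s: "(pderiv ^^ k) (rodrigues_base ^ n) = rodrigues_base ^ Suc (n - Suc k) * s"
    by (metis Suc_diff_Suc Suc_le_lessD Suc_leD dvdE)
  have "rodrigues_base ^ j dvd pderiv (rodrigues_base ^ Suc j * s)" for j
    unfolding pderiv_mult pderiv_power_Suc
    by (intro dvd_add dvd_mult2 dvd_mult dvd_smult dvd_refl le_imp_power_dvd) simp_all
  then show ?case by (simp add: s)
qed simp

lemma poly_integral_rodrigues:
  "k \<le> n \<Longrightarrow> poly_integral ((pderiv ^^ k) (rodrigues_base ^ n) * q)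
     = (-1) ^ k * poly_integral (rodrigues_base ^ n * (pderiv ^^ k) q)"
proof (induction k arbitrary: q)
  case (Suc k)
  let ?R = "(pderiv ^^ k) (rodrigues_base ^ n)"
  have "rodrigues_base dvd ?R"
    using rodrigues_base_power_dvd[of k n] Suc.prems
    by (metis Suc_diff_Suc Suc_le_lessD Suc_leD dvd_mult_left power_Suc)
  then obtain s where "?R = rodrigues_base * s" by (elim dvdE)
  then have "poly ?R 1 = 0" "poly ?R (-1) = 0"
    by simp_all
  then have "poly_integral (pderiv ?R * q) = - poly_integral (?R * pderiv q)"
    by (simp add: poly_integral_by_parts)
  also have "\<dots> = - ((-1) ^ k * poly_integral (rodrigues_base ^ n * (pderiv ^^ k) (pderiv q)))"
    using Suc by simp
  finally show ?case by (simp add: funpow_swap1)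
qed simp

text \<open>
  Integrating the derivative of \<open>x (x\<^sup>2 - 1)\<^bsup>n + 1\<^esup>\<close>, which has no boundary contribution, relates two
  consecutive integrals: \<open>(2n + 3) J\<^bsub>n + 1\<^esub> = -(2n + 2) J\<^sub>n\<close>.
\<close>

lemma poly_integral_rodrigues_base_power:
  "poly_integral (rodrigues_base ^ n) = (-1) ^ n * (2 * 4 ^ n) * (fact n)\<^sup>2 / fact (2 * n + 1)"
proof (induction n)
  case 0
  have "poly_integral (pderiv [:0, 1:]) = 2" by (simp add: poly_integral_pderiv)
  then show ?case by (simp add: pderiv_pCons one_pCons)
next
  case (Suc n)
  let ?A = rodrigues_base
  have quotient: "X = c / d * Y" if "d * X = c * Y" "d \<noteq> 0" for X Y c d :: real
    using that by (simp add: field_simps)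
  have ratio: "- (2 * m) / d * (s * (2 * p) * g\<^sup>2 / F) = - s * (8 * p) * (m * g)\<^sup>2 / (d * ((2 * m) * F))"
    if "m \<noteq> 0" "d \<noteq> 0" "F \<noteq> 0" for m d s p g F :: real
    using that by (simp add: field_simps power2_eq_square)
  have zero: "poly_integral (pderiv ([:0, 1:] * ?A ^ Suc n)) = 0"
    unfolding poly_integral_pderiv by simp
  have expand: "smult c B * (smult 2 A + [:2:]) = smult c (smult 2 (A * B) + smult 2 B)"
    for c and A B :: "real poly"
    by (simp add: distrib_left mult.commute smult_add_right)
  have deriv: "pderiv ([:0, 1:] * ?A ^ Suc n)
      = smult (2 * real n + 3) (?A ^ Suc n) + smult (2 * real n + 2) (?A ^ n)"
  proof -
    have x: "pderiv [:0, 1::real:] = 1" "pderiv ?A = [:0, 2:]"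
      by (simp_all add: pderiv_pCons one_pCons)
    have x2: "[:0, 1:] * [:0, 2:] = smult 2 ?A + [:2::real:]" by simp
    have "pderiv ([:0, 1:] * ?A ^ Suc n) = ?A ^ Suc n + smult (real (Suc n)) (?A ^ n) * ([:0, 1:] * [:0, 2:])"
      unfolding pderiv_mult pderiv_power_Suc x
      by (simp only: mult_1_right add.commute mult.left_commute[of "[:0, 1:]"])
    also have "\<dots> = ?A ^ Suc n + smult (real (Suc n)) (smult 2 (?A ^ Suc n) + smult 2 (?A ^ n))"
      unfolding x2 expand power_Suc ..
    also have "\<dots> = smult (2 * real n + 3) (?A ^ Suc n) + smult (2 * real n + 2) (?A ^ n)"
      by (rule poly_eqI) (simp add: algebra_simps del: power_Suc)
    finally show ?thesis .
  qed
  have "poly_integral (smult (2 * real n + 3) (?A ^ Suc n) + smult (2 * real n + 2) (?A ^ n)) = 0"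
    unfolding deriv[symmetric] by (rule zero)
  then have "(2 * real n + 3) * poly_integral (?A ^ Suc n) = - (2 * real n + 2) * poly_integral (?A ^ n)"
    unfolding poly_integral_add poly_integral_smult by linarith
  then have "poly_integral (?A ^ Suc n) = - (2 * real n + 2) / (2 * real n + 3) * poly_integral (?A ^ n)"
    by (intro quotient) simp_all
  also have "\<dots> = - (2 * (real n + 1)) / (2 * real n + 3)
      * ((-1) ^ n * (2 * 4 ^ n) * (fact n)\<^sup>2 / fact (2 * n + 1))"
  proof -
    have d: "2 * real n + 2 = 2 * (real n + 1)" by simp
    show ?thesis unfolding Suc.IH d ..
  qed
  also have "\<dots> = - ((-1) ^ n) * (8 * 4 ^ n) * ((real n + 1) * fact n)\<^sup>2
      / ((2 * real n + 3) * ((2 * (real n + 1)) * fact (2 * n + 1)))"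
    by (rule ratio) simp_all
  also have "\<dots> = (-1) ^ Suc n * (2 * 4 ^ Suc n) * (fact (Suc n))\<^sup>2 / fact (2 * Suc n + 1)"
  proof -
    have 1: "fact (2 * Suc n + 1) = (2 * real n + 3) * ((2 * (real n + 1)) * fact (2 * n + 1))"
      by (simp add: algebra_simps)
    have 2: "fact (Suc n) = (real n + 1) * fact n"
      by (simp add: add.commute)
    show ?thesis unfolding 1 2 by simp
  qed
  finally show ?case .
qed

lemma coeff_rodrigues_top: "coeff (rodrigues_base ^ n) (2 * n) = 1"
proof -
  have "degree (rodrigues_base ^ n) = 2 * n" by (simp add: degree_power_eq)
  then show ?thesis using lead_coeff_power[of rodrigues_base n] by simp
qed

lemma degree_legendre: "degree (legendre n) = n" and coeff_legendre_top: "coeff (legendre n) n = fact (2 * n) / (2 ^ n * (fact n)\<^sup>2)"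
proof -
  have d: "degree (rodrigues_base ^ n) = 2 * n" by (simp add: degree_power_eq)
  show top: "coeff (legendre n) n = fact (2 * n) / (2 ^ n * (fact n)\<^sup>2)"
  proof -
    have "pochhammer (1 + real n) n = fact (2 * n) / fact n"
      using pochhammer_product'[of "1::real" n n]
      by (simp add: pochhammer_fact[symmetric] mult_2[symmetric] field_simps)
    then show ?thesis
      using coeff_rodrigues_top[of n]
      by (simp add: legendre_def coeff_higher_pderiv mult_2[symmetric] power2_eq_square)
  qed
  show "degree (legendre n) = n"
  proof (rule antisym)
    show "degree (legendre n) \<le> n"
      by (rule degree_le) (auto simp: legendre_def coeff_higher_pderiv coeff_eq_0 d)
    show "n \<le> degree (legendre n)"
      by (rule le_degree) (simp add: top)
  qed
qed

lemma higher_pderiv_eq_0: "degree p < n \<Longrightarrow> (pderiv ^^ n) p = 0" for p :: "real poly"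
  by (rule poly_eqI) (simp add: coeff_higher_pderiv coeff_eq_0)

lemma legendre_orthogonal_lower: "degree q < n \<Longrightarrow> poly_integral (legendre n * q) = 0"
  using poly_integral_rodrigues[of n n q] by (simp add: legendre_def higher_pderiv_eq_0 poly_integral_def)

text \<open>
  Moving all \<open>n\<close> derivatives of Rodrigues' formula to the other factor annihilates polynomials of
  lower degree and leaves a constant multiple of \<open>(x\<^sup>2 - 1)\<^sup>n\<close> when the other factor is \<open>P\<^sub>n\<close> itself.
\<close>

lemma legendre_orthogonal:
  "poly_integral (legendre m * legendre n) = (if m = n then 2 / (2 * real n + 1) else 0)"
proof (cases m n rule: linorder_cases)
  case equal
  have "(pderiv ^^ n) (legendre n) = [:fact (2 * n) / (2 ^ n * fact n):]"
  proof (rule poly_eqI)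
    fix k
    show "coeff ((pderiv ^^ n) (legendre n)) k = coeff [:fact (2 * n) / (2 ^ n * fact n):] k"
      by (cases k) (auto simp: coeff_higher_pderiv coeff_legendre_top pochhammer_fact[symmetric] power2_eq_square
          coeff_eq_0 degree_legendre)
  qed
  then have "poly_integral (legendre n * legendre n)
      = (-1) ^ n / (2 ^ n * fact n) * (fact (2 * n) / (2 ^ n * fact n)) * poly_integral (rodrigues_base ^ n)"
    using poly_integral_rodrigues[of n n "legendre n"] by (subst legendre_def) simp
  also have "\<dots> = 2 / (2 * real n + 1)"
  proof -
    have *: "s / (P * G) * (F / (P * G)) * (s * (2 * (P * P)) * G\<^sup>2 / (d * F)) = 2 / d"
      if "s * s = 1" "P \<noteq> 0" "G \<noteq> 0" "F \<noteq> 0" "d \<noteq> 0" for s P G F d :: real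
      using that by (simp add: field_simps power2_eq_square)
    have 4: "4 ^ n = (2 ^ n * 2 ^ n :: real)" and f: "fact (2 * n + 1) = (2 * real n + 1) * fact (2 * n)"
      by (simp_all flip: power_mult_distrib)
    show ?thesis
      unfolding poly_integral_rodrigues_base_power 4 f
      by (rule *) (simp_all flip: power_mult_distrib)
  qed
  finally show ?thesis using equal by simp
qed (use legendre_orthogonal_lower[of "legendre m" n] legendre_orthogonal_lower[of "legendre n" m] in
      \<open>simp_all add: degree_legendre mult.commute\<close>)

lemma degree_legendre_pi: "degree (legendre_pi n) = n"
  by (simp add: legendre_pi_def degree_legendre degree_pcompose)

text \<open>
  Subtracting a multiple of \<open>P N\<close> removes the coefficient of degree \<open>N\<close>; hence a family with one
  polynomial of each degree spans all polynomials.
\<close>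

lemma poly_span_graded:
  fixes P :: "nat \<Rightarrow> real poly"
  assumes "\<And>n. degree (P n) = n" "\<And>n. P n \<noteq> 0"
  shows "(\<forall>k\<ge>N. coeff q k = 0) \<Longrightarrow> \<exists>b. q = (\<Sum>n<N. smult (b n) (P n))"
proof (induction N arbitrary: q)
  case 0
  then show ?case by (simp add: poly_eq_iff)
next
  case (Suc N)
  define c where "c = coeff q N / lead_coeff (P N)"
  have nz: "coeff (P N) N \<noteq> 0" using assms(1)[of N] assms(2)[of N] leading_coeff_0_iff by metis
  have "\<forall>k\<ge>N. coeff (q - smult c (P N)) k = 0"
  proof (intro allI impI)
    fix k assume "N \<le> k"
    show "coeff (q - smult c (P N)) k = 0"
    proof (cases "k = N")
      case True then show ?thesis using nz by (simp add: c_def assms(1))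
    next
      case False
      then show ?thesis using \<open>N \<le> k\<close> Suc.prems by (simp add: coeff_eq_0 assms(1))
    qed
  qed
  from Suc.IH[OF this] obtain b where b: "q - smult c (P N) = (\<Sum>n<N. smult (b n) (P n))" by blast
  have "q = (\<Sum>n<Suc N. smult ((b(N := c)) n) (P n))"
    using b by (simp add: algebra_simps)
  then show ?case by blast
qed

text \<open>
  The polynomials \<open>p\<^sub>n\<close>, cut off to \<open>[-\<pi>, \<pi>]\<close> and divided by \<open>\<surd>(2\<pi>)\<close>: this makes them orthonormal for
  Lebesgue measure instead of for the measure \<open>d\<omega> / (2\<pi>)\<close>.
\<close>

definition legendre_fn :: "nat \<Rightarrow> real \<Rightarrow> complex" where
  "legendre_fn n \<omega> = of_real (indicator {-pi..pi} \<omega> * (poly (legendre_pi n) \<omega> / sqrt (2 * pi)))"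

lemma legendre_fn_bounded: "\<exists>B. \<forall>x. norm (legendre_fn n x) \<le> B"
proof -
  have "bounded ((\<lambda>x. poly (legendre_pi n) x / sqrt (2 * pi)) ` {-pi..pi})"
    by (intro compact_imp_bounded compact_continuous_image continuous_intros) auto
  then obtain B where "\<forall>x\<in>{-pi..pi}. \<bar>poly (legendre_pi n) x / sqrt (2 * pi)\<bar> \<le> B"
    by (auto simp: bounded_iff)
  then have "norm (legendre_fn n x) \<le> max B 0" for x
    unfolding legendre_fn_def norm_of_real
    by (cases "x \<in> {-pi..pi}") (simp_all add: max.coboundedI1 del: atLeastAtMost_iff)
  then show ?thesis by blast
qed

lemma borel_measurable_poly_real [measurable]: "poly (p :: real poly) \<in> borel_measurable borel"
  by (intro borel_measurable_continuous_onI continuous_intros)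

lemma legendre_fn_measurable [measurable]: "legendre_fn n \<in> borel_measurable borel"
  unfolding legendre_fn_def[abs_def] by measurable

lemma square_integrable_legendre_fn [simp]: "square_integrable (legendre_fn n)"
proof -
  obtain B where "\<forall>x. norm (legendre_fn n x) \<le> B" using legendre_fn_bounded by blast
  then show ?thesis
    by (intro square_integrable_bounded_support[where B = B and a = "-pi" and b = pi])
      (auto simp: legendre_fn_def)
qed

lemma legendre_fn_orthonormal: "l2_inner (legendre_fn m) (legendre_fn n) = (if m = n then 1 else 0)"
proof -
  let ?r = "\<lambda>x. poly (legendre_pi m) x * poly (legendre_pi n) x * indicator {-pi..pi} x"
  have "l2_inner (legendre_fn m) (legendre_fn n) = (LBINT x. complex_of_real (?r x / (2 * pi)))"
    unfolding l2_inner_def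
    by (rule Bochner_Integration.integral_cong) (auto simp: legendre_fn_def indicator_def field_simps simp flip: of_real_mult)
  also have "\<dots> = of_real ((LBINT x. ?r x) / (2 * pi))"
    by (subst integral_complex_of_real) simp
  also have "(LBINT x. ?r x) = pi * (LBINT x. ?r (pi * x))"
    by (subst lborel_integral_real_affine[where c = pi and t = 0]) auto
  also have "(LBINT x. ?r (pi * x)) = (LBINT x. sqrt (2 * real m + 1) * sqrt (2 * real n + 1) *
      (poly (legendre m * legendre n) x * indicator {-1..1} x))"
  proof (rule Bochner_Integration.integral_cong)
    fix x
    have "(pi * x \<in> {-pi..pi}) = (x \<in> {-1..1})"
      using mult_le_cancel_left_pos[of pi "-1" x] mult_le_cancel_left_pos[of pi x 1] by auto
    then have "indicator {-pi..pi} (pi * x) = (indicator {-1..1} x :: real)"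
      by (simp only: indicator_def)
    then show "?r (pi * x) = sqrt (2 * real m + 1) * sqrt (2 * real n + 1) *
      (poly (legendre m * legendre n) x * indicator {-1..1} x)"
      by (simp only:) (simp add: legendre_pi_def poly_pcompose)
  qed simp
  also have "\<dots> = sqrt (2 * real m + 1) * sqrt (2 * real n + 1) * poly_integral (legendre m * legendre n)"
    by (simp add: poly_integral_def)
  also have "complex_of_real (pi * \<dots> / (2 * pi)) = (if m = n then 1 else 0)"
    by (cases "m = n") (simp_all add: legendre_orthogonal)
  finally show ?thesis .
qed

section \<open>Density of polynomials and Parseval's identity\<close>

lemma l2_norm_sq_dominated_convergence:
  fixes s :: "nat \<Rightarrow> real \<Rightarrow> complex"
  assumes [measurable]: "\<And>n. s n \<in> borel_measurable borel" "f \<in> borel_measurable borel"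
    and lim: "AE x in lborel. (\<lambda>n. s n x) \<longlonglongrightarrow> f x"
    and w: "integrable lborel w" "\<And>n x. (norm (s n x - f x))\<^sup>2 \<le> w x"
  shows "(\<lambda>n. l2_norm_sq (\<lambda>x. s n x - f x)) \<longlonglongrightarrow> 0"
proof -
  have "(\<lambda>n. LBINT x. (norm (s n x - f x))\<^sup>2) \<longlonglongrightarrow> (integral\<^sup>L lborel (\<lambda>x::real. 0 :: real))"
  proof (rule integral_dominated_convergence[where w = w])
    show "AE x in lborel. (\<lambda>n. (norm (s n x - f x))\<^sup>2) \<longlonglongrightarrow> 0"
      using lim
    proof eventually_elim
      case (elim x)
      then have "(\<lambda>n. (norm (s n x - f x))\<^sup>2) \<longlonglongrightarrow> (norm (f x - f x))\<^sup>2"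
        by (intro tendsto_intros)
      then show ?case by simp
    qed
    show "AE x in lborel. norm ((norm (s n x - f x))\<^sup>2) \<le> w x" for n
      using w(2) by simp
  qed (simp_all add: w(1))
  then show ?thesis by (simp add: l2_norm_sq_def)
qed

text \<open>
  A square-integrable function is close in norm to a truncation of its values to a disc; the
  truncation is an almost everywhere limit of continuous functions, and projecting these to the same
  disc supplies the bound needed for dominated convergence.
\<close>

lemma continuous_dense:
  fixes f :: "real \<Rightarrow> complex"
  assumes f [measurable]: "square_integrable f" and supp: "\<And>x. x \<notin> {-a..a} \<Longrightarrow> f x = 0"
    and e: "0 < e"
  shows "\<exists>g. continuous_on UNIV g \<and> l2_norm_sq (\<lambda>x. f x - indicator {-a..a} x *\<^sub>R g x) < e"
proof -
  (* The projection to the closed disc of radius n: continuous and norm-decreasing, unlike a cut-off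
     that sends large values to 0. *)
  define C :: "nat \<Rightarrow> complex \<Rightarrow> complex" where "C n = closest_point (cball 0 (real n))" for n
  have cont: "continuous_on UNIV (C n)" for n
    unfolding C_def by (intro continuous_on_closest_point) auto
  have [measurable]: "C n \<in> borel_measurable borel" for n
    by (rule borel_measurable_continuous_onI[OF cont])
  have C_le: "norm (C n z) \<le> real n" for n z
    using closest_point_in_set[of "cball 0 (real n)" z] by (simp add: C_def)
  have C_id: "C n z = z" if "norm z \<le> real n" for n z
    using that by (simp add: C_def closest_point_self)
  have C_le': "norm (C n z) \<le> norm z" for n z
    using C_le[of n z] C_id[of z n] by (cases "norm z \<le> real n") auto
  have C_lim: "(\<lambda>n. C n z) \<longlonglongrightarrow> z" for z
  proof (rule tendsto_eventually)
    show "\<forall>\<^sub>F n in sequentially. C n z = z"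
      using eventually_ge_at_top[of "nat \<lceil>norm z\<rceil>"]
      by eventually_elim (auto intro!: C_id simp: nat_le_iff ceiling_le_iff)
  qed
  have "(\<lambda>n. l2_norm_sq (\<lambda>x. C n (f x) - f x)) \<longlonglongrightarrow> 0"
  proof (rule l2_norm_sq_dominated_convergence)
    show "integrable lborel (\<lambda>x. 4 * (norm (f x))\<^sup>2)"
      using f by (auto intro: square_integrable_integrable_norm_sq)
    fix n x
    have "norm (C n (f x) - f x) \<le> 2 * norm (f x)"
      using norm_triangle_ineq4[of "C n (f x)" "f x"] C_le'[of n "f x"] by simp
    then have "(norm (C n (f x) - f x))\<^sup>2 \<le> (2 * norm (f x))\<^sup>2"
      by (rule power_mono) simp
    then show "(norm (C n (f x) - f x))\<^sup>2 \<le> 4 * (norm (f x))\<^sup>2"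
      by (simp add: power_mult_distrib)
  qed (use C_lim in simp_all)
  from order_tendstoD(2)[OF this, of "e / 4"]
  have "\<forall>\<^sub>F n in sequentially. l2_norm_sq (\<lambda>x. C n (f x) - f x) < e / 4"
    using e by simp
  then obtain n where n: "l2_norm_sq (\<lambda>x. C n (f x) - f x) < e / 4"
    using eventually_happens'[OF sequentially_bot] by blast
  have Cf: "square_integrable (\<lambda>x. C n (f x))"
    by (rule square_integrable_bound[where g = "\<lambda>x. (norm (f x))\<^sup>2"])
      (use f C_le' in \<open>auto intro!: square_integrable_integrable_norm_sq power_mono\<close>)
  have "f \<in> borel_measurable lebesgue"
    using f by (auto intro!: measurable_completion)
  then have "f measurable_on UNIV"
    by (rule lebesgue_measurable_imp_measurable_on) simp
  then obtain N h where N: "negligible N" and h: "\<And>k. continuous_on UNIV (h k)"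
    and h_lim: "\<And>x. x \<notin> N \<Longrightarrow> (\<lambda>k. h k x) \<longlonglongrightarrow> f x"
    unfolding measurable_on_def by auto
  have [measurable]: "h k \<in> borel_measurable borel" for k
    by (rule borel_measurable_continuous_onI[OF h])
  let ?I = "indicator {-a..a} :: real \<Rightarrow> real"
  have bd: "norm (?I x *\<^sub>R C n (h k x)) \<le> real n" for k x
    using C_le[of n "h k x"] by (auto simp: indicator_def)
  have Ch: "square_integrable (\<lambda>x. ?I x *\<^sub>R C n (h k x))" for k
    by (rule square_integrable_bounded_support[where a = "-a" and b = a and B = "real n"])
      (use bd in \<open>auto\<close>)
  have "(\<lambda>k. l2_norm_sq (\<lambda>x. ?I x *\<^sub>R C n (h k x) - C n (f x))) \<longlonglongrightarrow> 0"
  proof (rule l2_norm_sq_dominated_convergence)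
    show "integrable lborel (\<lambda>x. (2 * real n)\<^sup>2 * ?I x)"
      by (intro integrable_mult_right integrable_real_indicator) (simp_all add: emeasure_lborel_Icc_eq)
    have "AE x in lborel. x \<notin> N"
      using AE_not_in[of N lebesgue] N unfolding negligible_iff_null_sets AE_completion_iff by blast
    then show "AE x in lborel. (\<lambda>k. ?I x *\<^sub>R C n (h k x)) \<longlonglongrightarrow> C n (f x)"
    proof eventually_elim
      case (elim x)
      have "(\<lambda>k. C n (h k x)) \<longlonglongrightarrow> C n (f x)"
        by (rule continuous_on_tendsto_compose[OF cont h_lim[OF elim]]) simp_all
      moreover have "C n (f x) = 0" if "x \<notin> {-a..a}"
        using supp[OF that] by (simp add: C_id)
      ultimately show ?case
        by (cases "x \<in> {-a..a}") (auto simp del: atLeastAtMost_iff)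
    qed
    fix k x
    show "(norm (?I x *\<^sub>R C n (h k x) - C n (f x)))\<^sup>2 \<le> (2 * real n)\<^sup>2 * ?I x"
    proof (cases "x \<in> {-a..a}")
      case True
      have "norm (C n (h k x) - C n (f x)) \<le> 2 * real n"
        using norm_triangle_ineq4[of "C n (h k x)" "C n (f x)"] C_le[of n "h k x"] C_le[of n "f x"]
        by linarith
      then have "(norm (C n (h k x) - C n (f x)))\<^sup>2 \<le> (2 * real n)\<^sup>2"
        by (rule power_mono) simp
      then show ?thesis using True by simp
    next
      case False
      then show ?thesis using supp[OF False] by (simp add: C_id)
    qed
  qed simp_all
  from order_tendstoD(2)[OF this, of "e / 4"]
  have "\<forall>\<^sub>F k in sequentially. l2_norm_sq (\<lambda>x. ?I x *\<^sub>R C n (h k x) - C n (f x)) < e / 4"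
    using e by simp
  then obtain k where k: "l2_norm_sq (\<lambda>x. ?I x *\<^sub>R C n (h k x) - C n (f x)) < e / 4"
    using eventually_happens'[OF sequentially_bot] by blast
  have "l2_norm_sq (\<lambda>x. (f x - C n (f x)) + (C n (f x) - ?I x *\<^sub>R C n (h k x)))
      \<le> 2 * l2_norm_sq (\<lambda>x. f x - C n (f x)) + 2 * l2_norm_sq (\<lambda>x. C n (f x) - ?I x *\<^sub>R C n (h k x))"
    using f Cf Ch by (intro l2_norm_sq_add_le square_integrable_diff)
  also have "\<dots> < e"
    using n k unfolding l2_norm_sq_minus_commute[of f "\<lambda>x. C n (f x)"]
      l2_norm_sq_minus_commute[of "\<lambda>x. C n (f x)" "\<lambda>x. ?I x *\<^sub>R C n (h k x)"] by linarith
  finally have "l2_norm_sq (\<lambda>x. f x - ?I x *\<^sub>R (C n (h k x))) < e"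
    by simp
  moreover have "continuous_on UNIV (\<lambda>x. C n (h k x))"
    using continuous_on_compose2[OF cont h] by simp
  ultimately show ?thesis by blast
qed

lemma real_polynomial_function_poly:
  fixes g :: "real \<Rightarrow> real"
  assumes "real_polynomial_function g"
  shows "\<exists>p. g = poly p"
proof -
  obtain b n where "g = (\<lambda>x. \<Sum>i\<le>n. b i * x ^ i)"
    using assms real_polynomial_function_iff_sum by auto
  then have "g = poly (\<Sum>i\<le>n. monom (b i) i)"
    by (simp add: fun_eq_iff poly_sum poly_monom)
  then show ?thesis by blast
qed

text \<open>
  Density of continuous functions combined with the Weierstrass theorem, as uniform closeness on a
  bounded interval implies closeness in the square mean.
\<close>

lemma polynomials_dense:
  fixes f :: "real \<Rightarrow> complex"
  assumes f: "square_integrable f" and supp: "\<And>x. x \<notin> {-a..a} \<Longrightarrow> f x = 0"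
    and e: "0 < e" and a: "0 < a"
  shows "\<exists>p q. l2_norm_sq (\<lambda>x. f x - indicator {-a..a} x *\<^sub>R Complex (poly p x) (poly q x)) < e"
proof -
  have "0 < e / 4" using e by simp
  from continuous_dense[OF f supp this] obtain g where g: "continuous_on UNIV g"
    and fg: "l2_norm_sq (\<lambda>x. f x - indicator {-a..a} x *\<^sub>R g x) < e / 4" by auto
  (* With this uniform error on an interval of length 2 a the squared error is e / 8. *)
  define d where "d = sqrt (e / (16 * a))"
  have d: "0 < d" "d\<^sup>2 = e / (16 * a)" using e a by (simp_all add: d_def)
  obtain G where G: "polynomial_function G" and gG: "\<And>x. x \<in> {-a..a} \<Longrightarrow> norm (g x - G x) < d"
    using Stone_Weierstrass_polynomial_function[of "{-a..a}" g d] d(1) continuous_on_subset[OF g]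
    by (metis compact_Icc subset_UNIV)
  have "real_polynomial_function (Re \<circ> G)" "real_polynomial_function (Im \<circ> G)"
    using G bounded_linear_Re bounded_linear_Im unfolding polynomial_function_def by blast+
  then obtain p q where pq: "Re \<circ> G = poly p" "Im \<circ> G = poly q"
    using real_polynomial_function_poly by metis
  have G_eq: "G x = Complex (poly p x) (poly q x)" for x
    using fun_cong[OF pq(1), of x] fun_cong[OF pq(2), of x] by (simp add: complex_eq_iff)
  let ?I = "indicator {-a..a} :: real \<Rightarrow> real"
  have contG: "continuous_on UNIV G" using G by (rule continuous_on_polymonial_function)
  have [measurable]: "g \<in> borel_measurable borel" "G \<in> borel_measurable borel"
    using g contG by (auto intro: borel_measurable_continuous_onI)
  have sqI: "square_integrable (\<lambda>x. ?I x *\<^sub>R h x)" if "continuous_on UNIV h" for h :: "real \<Rightarrow> complex"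
  proof -
    have [measurable]: "h \<in> borel_measurable borel" by (rule borel_measurable_continuous_onI[OF that])
    have "bounded (h ` {-a..a})"
      by (intro compact_imp_bounded compact_continuous_image continuous_on_subset[OF that]) auto
    then obtain B where "0 < B" "\<forall>x\<in>{-a..a}. norm (h x) \<le> B"
      by (auto simp: bounded_pos)
    then show ?thesis
      by (intro square_integrable_bounded_support[where a = "-a" and b = a and B = B])
        (auto simp: indicator_def)
  qed
  have "l2_norm_sq (\<lambda>x. ?I x *\<^sub>R g x - ?I x *\<^sub>R G x) \<le> (LBINT x. d\<^sup>2 * ?I x)"
    unfolding l2_norm_sq_def
  proof (rule integral_mono)
    show "integrable lborel (\<lambda>x. (norm (?I x *\<^sub>R g x - ?I x *\<^sub>R G x))\<^sup>2)"
      by (intro square_integrable_integrable_norm_sq square_integrable_diff sqI g contG)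
    show "integrable lborel (\<lambda>x. d\<^sup>2 * ?I x)"
      by (intro integrable_mult_right integrable_real_indicator) (simp_all add: emeasure_lborel_Icc_eq)
    fix x
    show "(norm (?I x *\<^sub>R g x - ?I x *\<^sub>R G x))\<^sup>2 \<le> d\<^sup>2 * ?I x"
      using power_mono[OF less_imp_le[OF gG[of x]], of 2] by (auto simp: indicator_def)
  qed
  also have "\<dots> = e / 8"
    using a d by (simp add: measure_lborel_Icc)
  finally have "l2_norm_sq (\<lambda>x. ?I x *\<^sub>R g x - ?I x *\<^sub>R G x) \<le> e / 8" .
  moreover have "l2_norm_sq (\<lambda>x. (f x - ?I x *\<^sub>R g x) + (?I x *\<^sub>R g x - ?I x *\<^sub>R G x))
      \<le> 2 * l2_norm_sq (\<lambda>x. f x - ?I x *\<^sub>R g x) + 2 * l2_norm_sq (\<lambda>x. ?I x *\<^sub>R g x - ?I x *\<^sub>R G x)"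
    by (intro l2_norm_sq_add_le square_integrable_diff sqI g contG f)
  ultimately have "l2_norm_sq (\<lambda>x. f x - ?I x *\<^sub>R G x) < e"
    using fg e by simp
  then show ?thesis unfolding G_eq by blast
qed

text \<open>
  The distance to a finite linear combination splits into the distance to the span and the
  deviation of the coefficients from the Fourier coefficients. It contains Bessel's inequality, the
  best approximation property and Pythagoras' theorem.
\<close>

lemma l2_norm_sq_diff_combination:
  fixes e :: "'i \<Rightarrow> real \<Rightarrow> complex"
  assumes e: "\<And>n. square_integrable (e n)"
    and orth: "\<And>m n. l2_inner (e m) (e n) = (if m = n then 1 else 0)"
    and f: "square_integrable f" and "finite A"
  shows "l2_norm_sq (\<lambda>x. f x - (\<Sum>n\<in>A. a n * e n x)) =
    l2_norm_sq f - (\<Sum>n\<in>A. (norm (l2_inner f (e n)))\<^sup>2) + (\<Sum>n\<in>A. (norm (l2_inner f (e n) - a n))\<^sup>2)"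
  using \<open>finite A\<close>
proof (induction A)
  case empty
  then show ?case by simp
next
  case (insert m A)
  define g where "g = (\<lambda>x. f x - (\<Sum>n\<in>A. a n * e n x))"
  have s: "square_integrable (\<lambda>x. \<Sum>n\<in>A. a n * e n x)"
    by (intro square_integrable_sum square_integrable_mult_left e)
  have g: "square_integrable g"
    unfolding g_def by (intro square_integrable_diff f s)
  have em: "l2_norm_sq (e m) = 1"
  proof -
    have "complex_of_real (l2_norm_sq (e m)) = l2_inner (e m) (e m)"
      unfolding l2_norm_sq_def l2_inner_def
      by (simp add: complex_norm_square[symmetric] flip: integral_complex_of_real)
    then show ?thesis using orth[of m m] by simp
  qed
  have inner: "l2_inner g (e m) = l2_inner f (e m)"
    unfolding g_def l2_inner_diff_left[OF f s e]
    using insert.hyps by (subst l2_inner_sum_left) (auto intro: e simp: orth intro!: sum.neutral)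
  have "l2_norm_sq (\<lambda>x. f x - (\<Sum>n\<in>insert m A. a n * e n x)) = l2_norm_sq (\<lambda>x. g x - a m * e m x)"
    using insert.hyps by (simp add: g_def algebra_simps)
  also have "\<dots> = l2_norm_sq g - 2 * Re (l2_inner g (\<lambda>x. a m * e m x)) + (norm (a m))\<^sup>2"
    using g e by (subst l2_norm_sq_diff) (auto simp: em)
  also have "l2_inner g (\<lambda>x. a m * e m x) = cnj (a m) * l2_inner f (e m)"
    unfolding inner[symmetric] unfolding l2_inner_def integral_mult_right_zero[symmetric]
    by (rule Bochner_Integration.integral_cong) simp_all
  also have "l2_norm_sq g - 2 * Re (cnj (a m) * l2_inner f (e m)) + (norm (a m))\<^sup>2
      = l2_norm_sq g - (norm (l2_inner f (e m)))\<^sup>2 + (norm (l2_inner f (e m) - a m))\<^sup>2"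
    by (simp only: cmod_power2) (simp add: power2_eq_square algebra_simps)
  finally show ?case
    using insert by (simp add: g_def)
qed

lemma l2_norm_sq_combination:
  fixes e :: "'i \<Rightarrow> real \<Rightarrow> complex"
  assumes e: "\<And>n. square_integrable (e n)"
    and orth: "\<And>m n. l2_inner (e m) (e n) = (if m = n then 1 else 0)"
    and "finite A"
  shows "l2_norm_sq (\<lambda>x. \<Sum>n\<in>A. a n * e n x) = (\<Sum>n\<in>A. (norm (a n))\<^sup>2)"
  using l2_norm_sq_diff_combination[of e "\<lambda>x. 0" A a, OF e orth _ \<open>finite A\<close>]
  by (simp add: l2_norm_sq_def)

lemma parseval:
  fixes e :: "nat \<Rightarrow> real \<Rightarrow> complex"
  assumes e: "\<And>n. square_integrable (e n)"
    and orth: "\<And>m n. l2_inner (e m) (e n) = (if m = n then 1 else 0)"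
    and f: "square_integrable f"
    and dense: "\<And>\<epsilon>. 0 < \<epsilon> \<Longrightarrow> \<exists>N a. l2_norm_sq (\<lambda>x. f x - (\<Sum>n<N. a n * e n x)) < \<epsilon>"
  shows "(\<lambda>n. (norm (l2_inner f (e n)))\<^sup>2) sums l2_norm_sq f"
  unfolding sums_def
proof (rule LIMSEQ_I)
  let ?S = "\<lambda>N. \<Sum>n<N. (norm (l2_inner f (e n)))\<^sup>2"
  have eq: "l2_norm_sq (\<lambda>x. f x - (\<Sum>n<N. a n * e n x))
    = l2_norm_sq f - ?S N + (\<Sum>n<N. (norm (l2_inner f (e n) - a n))\<^sup>2)" for a N
    by (rule l2_norm_sq_diff_combination[OF e orth f]) simp
  fix r :: real assume "0 < r"
  then obtain M a where M: "l2_norm_sq (\<lambda>x. f x - (\<Sum>n<M. a n * e n x)) < r"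
    using dense by blast
  have low: "l2_norm_sq f - ?S M < r"
    using M eq[of a M] sum_nonneg[of "{..<M}" "\<lambda>n. (norm (l2_inner f (e n) - a n))\<^sup>2"] by simp
  have up: "?S N \<le> l2_norm_sq f" for N
    using eq[of "\<lambda>n. l2_inner f (e n)" N] l2_norm_sq_nonneg[of "\<lambda>x. f x - (\<Sum>n<N. l2_inner f (e n) * e n x)"]
    by simp
  have "norm (?S N - l2_norm_sq f) < r" if "N \<ge> M" for N
  proof -
    have "?S M \<le> ?S N" by (rule sum_mono2) (use that in auto)
    then show ?thesis using low up[of N] by simp
  qed
  then show "\<exists>M. \<forall>N\<ge>M. norm (?S N - l2_norm_sq f) < r" by blast
qed

lemma legendre_fn_span:
  assumes "\<And>k. N \<le> k \<Longrightarrow> coeff p k = 0"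
  shows "\<exists>b :: nat \<Rightarrow> real. \<forall>x. of_real (indicator {-pi..pi} x * poly p x) = (\<Sum>n<N. of_real (b n) * legendre_fn n x)"
proof -
  have nz: "legendre_pi n \<noteq> 0" for n
  proof (cases "n = 0")
    case True
    then show ?thesis by (simp add: legendre_pi_def legendre_def)
  next
    case False
    then show ?thesis using degree_legendre_pi[of n] by auto
  qed
  obtain b where b: "p = (\<Sum>n<N. smult (b n) (legendre_pi n))"
    using poly_span_graded[of legendre_pi N p] assms degree_legendre_pi nz by auto
  have "of_real (indicator {-pi..pi} x * poly p x) = (\<Sum>n<N. of_real (sqrt (2 * pi) * b n) * legendre_fn n x)" for x
    by (subst b) (simp add: poly_sum legendre_fn_def sum_distrib_left mult_ac)
  then show ?thesis by (intro exI[of _ "\<lambda>n. sqrt (2 * pi) * b n"] allI)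
qed

lemma legendre_parseval:
  assumes f: "square_integrable f" and supp: "\<And>x. x \<notin> {-pi..pi} \<Longrightarrow> f x = 0"
  shows "(\<lambda>n. (norm (l2_inner f (legendre_fn n)))\<^sup>2) sums l2_norm_sq f"
proof (rule parseval[OF square_integrable_legendre_fn legendre_fn_orthonormal f])
  fix \<epsilon> :: real assume \<epsilon>: "0 < \<epsilon>"
  from polynomials_dense[OF f supp this pi_gt_zero] obtain p q where
    pq: "l2_norm_sq (\<lambda>x. f x - indicator {-pi..pi} x *\<^sub>R Complex (poly p x) (poly q x)) < \<epsilon>" by auto
  define N where "N = Suc (max (degree p) (degree q))"
  obtain b where b: "\<And>x. of_real (indicator {-pi..pi} x * poly p x) = (\<Sum>n<N. of_real (b n) * legendre_fn n x)"
    using legendre_fn_span[of N p] by (auto simp: N_def coeff_eq_0)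
  obtain c where c: "\<And>x. of_real (indicator {-pi..pi} x * poly q x) = (\<Sum>n<N. of_real (c n) * legendre_fn n x)"
    using legendre_fn_span[of N q] by (auto simp: N_def coeff_eq_0)
  have "indicator {-pi..pi} x *\<^sub>R Complex (poly p x) (poly q x) = (\<Sum>n<N. Complex (b n) (c n) * legendre_fn n x)" for x
  proof -
    have "indicator {-pi..pi} x *\<^sub>R Complex (poly p x) (poly q x)
       = of_real (indicator {-pi..pi} x * poly p x) + \<i> * of_real (indicator {-pi..pi} x * poly q x)"
      by (simp add: complex_eq_iff)
    also have "\<dots> = (\<Sum>n<N. Complex (b n) (c n) * legendre_fn n x)"
      unfolding b c by (simp add: sum_distrib_left sum.distrib[symmetric] Complex_eq algebra_simps)
    finally show ?thesis .
  qed
  with pq show "\<exists>N a. l2_norm_sq (\<lambda>x. f x - (\<Sum>n<N. a n * legendre_fn n x)) < \<epsilon>"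
    by (intro exI[of _ N] exI[of _ "\<lambda>n. Complex (b n) (c n)"]) simp
qed

section \<open>The Riesz--Fischer theorem\<close>

text \<open>
  The integral of the sum of the norms is finite, so the sum itself is finite almost everywhere.
\<close>

lemma AE_summable_of_summable_integral_norm:
  fixes D :: "nat \<Rightarrow> 'a \<Rightarrow> complex"
  assumes D: "\<And>k. integrable M (D k)" and sum: "summable (\<lambda>k. LINT x|M. norm (D k x))"
  shows "AE x in M. summable (\<lambda>k. norm (D k x))"
proof -
  have [measurable]: "D k \<in> borel_measurable M" for k using D by auto
  have "(\<integral>\<^sup>+x. (\<Sum>k. ennreal (norm (D k x))) \<partial>M) = (\<Sum>k. \<integral>\<^sup>+x. ennreal (norm (D k x)) \<partial>M)"
    by (rule nn_integral_suminf) simp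
  also have "\<dots> = (\<Sum>k. ennreal (LINT x|M. norm (D k x)))"
    by (intro arg_cong[where f = suminf] ext nn_integral_eq_integral integrable_norm D) simp
  also have "\<dots> \<noteq> \<infinity>"
    unfolding infinity_ennreal_def by (rule ennreal_suminf_neq_top[OF sum]) simp
  finally have "AE x in M. (\<Sum>k. ennreal (norm (D k x))) \<noteq> \<infinity>"
    by (intro nn_integral_noteq_infinite) auto
  then show ?thesis
    by eventually_elim (auto intro!: summable_suminf_not_top)
qed

text \<open>
  Integrating \<open>\<bar>f\<bar> \<le> \<delta> + \<bar>f\<bar>\<^sup>2 / \<delta>\<close>, which holds in either case \<open>\<bar>f\<bar> \<le> \<delta>\<close> or \<open>\<bar>f\<bar> \<ge> \<delta>\<close>. It serves in place
  of the Cauchy--Schwarz inequality: choosing \<open>\<delta>\<close> of the size of the \<open>L\<^sup>2\<close> norm bounds the \<open>L\<^sup>1\<close> norm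
  by a multiple of it.
\<close>

lemma l1_norm_le_l2_norm_sq:
  fixes f :: "real \<Rightarrow> complex"
  assumes f: "square_integrable f" and supp: "\<And>x. x \<notin> {-a..a} \<Longrightarrow> f x = 0" and \<delta>: "0 < \<delta>" and a: "0 < a"
  shows "(LBINT x. norm (f x)) \<le> \<delta> * (2 * a) + l2_norm_sq f / \<delta>"
proof -
  have "(LBINT x. norm (f x)) \<le> (LBINT x. \<delta> * indicator {-a..a} x + (norm (f x))\<^sup>2 / \<delta>)"
  proof (rule integral_mono)
    show "integrable lborel (\<lambda>x. norm (f x))"
      using square_integrable_imp_integrable[OF f supp] by simp
    show "integrable lborel (\<lambda>x. \<delta> * indicator {-a..a} x + (norm (f x))\<^sup>2 / \<delta>)"
      by (intro Bochner_Integration.integrable_add integrable_mult_right integrable_real_indicator integrable_divide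
         square_integrable_integrable_norm_sq f)
        (simp_all add: emeasure_lborel_Icc_eq)
    fix x
    have "norm (f x) \<le> \<delta> + (norm (f x))\<^sup>2 / \<delta>"
    proof (cases "norm (f x) \<le> \<delta>")
      case False
      then have "\<delta> * norm (f x) \<le> (norm (f x))\<^sup>2"
        unfolding power2_eq_square by (intro mult_right_mono) auto
      then have "norm (f x) \<le> (norm (f x))\<^sup>2 / \<delta>"
        using \<delta> by (simp add: pos_le_divide_eq mult.commute)
      then show ?thesis using \<delta> by simp
    qed (use \<delta> in \<open>simp add: add_increasing2\<close>)
    then show "norm (f x) \<le> \<delta> * indicator {-a..a} x + (norm (f x))\<^sup>2 / \<delta>"
      using supp[of x] by (cases "x \<in> {-a..a}") (simp_all del: atLeastAtMost_iff)
  qed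
  also have "\<dots> = \<delta> * (2 * a) + l2_norm_sq f / \<delta>"
    unfolding l2_norm_sq_def
    using a by (subst Bochner_Integration.integral_add)
      (auto intro!: integrable_mult_right integrable_real_indicator square_integrable_integrable_norm_sq f
        simp: emeasure_lborel_Icc_eq measure_lborel_Icc)
  finally show ?thesis .
qed

text \<open>
  The series is grouped into blocks \<open>D k\<close>, of norm at most \<open>2\<^bsup>-k\<^esup>\<close> for \<open>k > 0\<close>. The common bounded support
  makes the blocks summable in \<open>L\<^sup>1\<close>, which gives convergence almost everywhere; Fatou's lemma places
  the limit in \<open>L\<^sup>2\<close>. As each \<open>e n\<close> is bounded, convergence in \<open>L\<^sup>1\<close> is enough to identify the
  coefficients.
\<close>

lemma riesz_fischer:
  fixes e :: "nat \<Rightarrow> real \<Rightarrow> complex" and c :: "nat \<Rightarrow> complex"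
  assumes e: "\<And>n. square_integrable (e n)"
    and orth: "\<And>m n. l2_inner (e m) (e n) = (if m = n then 1 else 0)"
    and supp: "\<And>n x. x \<notin> {-a..a} \<Longrightarrow> e n x = 0" and a: "0 < a"
    and bounded: "\<And>n. \<exists>B. \<forall>x. norm (e n x) \<le> B"
    and c: "summable (\<lambda>n. (norm (c n))\<^sup>2)"
  shows "\<exists>f. square_integrable f \<and> (\<forall>x. x \<notin> {-a..a} \<longrightarrow> f x = 0) \<and> (\<forall>n. l2_inner f (e n) = c n)"
proof -
  have [measurable]: "e n \<in> borel_measurable borel" for n
    using e by (rule square_integrable_measurable)
  have "\<exists>N. \<forall>m n. N \<le> m \<longrightarrow> (\<Sum>j = m..<n. (norm (c j))\<^sup>2) < (1 / 4) ^ Suc k" for k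
    using c[unfolded summable_Cauchy, rule_format, of "(1/4) ^ Suc k"]
    by (auto simp del: power_Suc intro: order.strict_trans1[OF abs_ge_self])
  then obtain N where N: "\<And>k m n. N k \<le> m \<Longrightarrow> (\<Sum>j = m..<n. (norm (c j))\<^sup>2) < (1 / 4) ^ Suc k"
    by metis
  (* The summand 1 makes r unbounded, so that every index occurs in some block. *)
  define r where "r k = (\<Sum>i<k. N i + 1)" for k
  have r0: "r 0 = 0" and r_Suc: "r (Suc k) = r k + N k + 1" for k
    by (simp_all add: r_def)
  have r_ge: "k \<le> r k" for k
    by (induction k) (simp_all add: r_Suc)
  define D where "D k x = (\<Sum>n = r k..<r (Suc k). c n * e n x)" for k x
  have D: "square_integrable (D k)" for k
    unfolding D_def by (intro square_integrable_sum square_integrable_mult_left e)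
  note [measurable] = square_integrable_measurable[OF D]
  have D_supp: "D k x = 0" if "x \<notin> {-a..a}" for k x
    using supp[OF that] by (simp add: D_def)
  have D_int: "integrable lborel (D k)" for k
    by (rule square_integrable_imp_integrable[OF D D_supp])
  have D_sum: "(\<Sum>k<K. D k x) = (\<Sum>n<r K. c n * e n x)" for K x
  proof (induction K)
    case (Suc K)
    have "{..<r (Suc K)} = {..<r K} \<union> {r K..<r (Suc K)}" "{..<r K} \<inter> {r K..<r (Suc K)} = {}"
      by (auto simp: r_Suc)
    then show ?case using Suc by (simp add: D_def sum.union_disjoint)
  qed (simp add: r0)
  have D_norm: "l2_norm_sq (D (Suc k)) \<le> (1 / 4) ^ Suc k" for k
  proof -
    have "l2_norm_sq (D (Suc k)) = (\<Sum>n = r (Suc k)..<r (Suc (Suc k)). (norm (c n))\<^sup>2)"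
      unfolding D_def by (rule l2_norm_sq_combination[OF e orth]) simp
    also have "\<dots> < (1 / 4) ^ Suc k" by (rule N) (simp add: r_Suc)
    finally show ?thesis by simp
  qed
  have L1: "summable (\<lambda>k. LBINT x. norm (D k x))"
  proof (subst summable_Suc_iff[symmetric], rule summable_comparison_test')
    show "summable (\<lambda>k. (1 / 2) ^ Suc k * (2 * a + 1) :: real)"
      by (intro summable_mult2 summable_ignore_initial_segment[where k = 1, simplified] summable_geometric) simp
    fix k :: nat
    have "(LBINT x. norm (D (Suc k) x)) \<le> (1/2) ^ Suc k * (2 * a) + l2_norm_sq (D (Suc k)) / (1/2) ^ Suc k"
      by (rule l1_norm_le_l2_norm_sq[OF D D_supp _ a], assumption, rule zero_less_power, simp)
    also have "\<dots> \<le> (1/2) ^ Suc k * (2 * a) + (1/4) ^ Suc k / (1/2) ^ Suc k"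
      by (intro add_left_mono divide_right_mono D_norm) simp
    also have "(1/4 :: real) ^ Suc k / (1/2) ^ Suc k = (1/2) ^ Suc k"
      by (simp only: power_divide[symmetric]) simp
    finally show "norm (LBINT x. norm (D (Suc k) x)) \<le> (1 / 2) ^ Suc k * (2 * a + 1)"
      by (simp add: distrib_left)
  qed
  have AE_D: "AE x in lborel. summable (\<lambda>k. norm (D k x))"
    by (rule AE_summable_of_summable_integral_norm[OF D_int L1])
  define f where "f x = (\<Sum>k. D k x)" for x
  have [measurable]: "f \<in> borel_measurable borel"
    unfolding f_def by measurable
  have f_supp: "f x = 0" if "x \<notin> {-a..a}" for x
    using D_supp[OF that] by (simp add: f_def)
  have partial: "l2_norm_sq (\<lambda>x. \<Sum>k<K. D k x) \<le> (\<Sum>n. (norm (c n))\<^sup>2)" for K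
  proof -
    have "l2_norm_sq (\<lambda>x. \<Sum>k<K. D k x) = (\<Sum>n<r K. (norm (c n))\<^sup>2)"
      unfolding D_sum by (rule l2_norm_sq_combination[OF e orth]) simp
    also have "\<dots> \<le> (\<Sum>n. (norm (c n))\<^sup>2)"
      by (rule sum_le_suminf[OF c]) auto
    finally show ?thesis .
  qed
  have S: "square_integrable (\<lambda>x. \<Sum>k<K. D k x)" for K
    by (intro square_integrable_sum D)
  have "(\<integral>\<^sup>+x. ennreal ((norm (f x))\<^sup>2) \<partial>lborel)
      = (\<integral>\<^sup>+x. liminf (\<lambda>K. ennreal ((norm (\<Sum>k<K. D k x))\<^sup>2)) \<partial>lborel)"
  proof (rule nn_integral_cong_AE)
    show "AE x in lborel. ennreal ((norm (f x))\<^sup>2) = liminf (\<lambda>K. ennreal ((norm (\<Sum>k<K. D k x))\<^sup>2))"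
      using AE_D
    proof eventually_elim
      case (elim x)
      have "(\<lambda>K. \<Sum>k<K. D k x) \<longlonglongrightarrow> f x"
        unfolding f_def by (rule summable_LIMSEQ[OF summable_norm_cancel[OF elim]])
      then have "(\<lambda>K. ennreal ((norm (\<Sum>k<K. D k x))\<^sup>2)) \<longlonglongrightarrow> ennreal ((norm (f x))\<^sup>2)"
        by (intro tendsto_ennrealI tendsto_intros)
      then show ?case by (intro lim_imp_Liminf[symmetric]) simp_all
    qed
  qed
  also have "\<dots> \<le> liminf (\<lambda>K. \<integral>\<^sup>+x. ennreal ((norm (\<Sum>k<K. D k x))\<^sup>2) \<partial>lborel)"
    by (rule nn_integral_liminf) measurable
  also have "\<dots> = liminf (\<lambda>K. ennreal (l2_norm_sq (\<lambda>x. \<Sum>k<K. D k x)))"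
    unfolding nn_integral_norm_sq[OF S] ..
  also have "\<dots> \<le> ennreal (\<Sum>n. (norm (c n))\<^sup>2)"
    by (rule Liminf_le) (simp_all add: partial ennreal_leI)
  finally have "(\<integral>\<^sup>+x. ennreal ((norm (f x))\<^sup>2) \<partial>lborel) < \<infinity>"
    by (rule order.strict_trans1) simp
  then have f: "square_integrable f"
    unfolding square_integrable_def by (auto intro: integrableI_bounded)
  have "l2_inner f (e n) = c n" for n
  proof -
    obtain B where B: "\<And>x. norm (e n x) \<le> B" using bounded by blast
    have "(\<lambda>k. LBINT x. D k x * cnj (e n x)) sums (LBINT x. (\<Sum>k. D k x * cnj (e n x)))"
    proof (rule sums_integral)
      show "integrable lborel (\<lambda>x. D k x * cnj (e n x))" for k
        by (rule square_integrable_inner_integrable[OF D e])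
      have bd: "norm (D k x * cnj (e n x)) \<le> B * norm (D k x)" for k x
        using mult_right_mono[OF B[of x] norm_ge_zero[of "D k x"]] by (simp add: norm_mult mult.commute)
      show "AE x in lborel. summable (\<lambda>k. norm (D k x * cnj (e n x)))"
        using AE_D
      proof eventually_elim
        case (elim x)
        show ?case
          by (rule summable_comparison_test'[OF summable_mult[OF elim, of B], of 0]) (use bd in auto)
      qed
      show "summable (\<lambda>k. LBINT x. norm (D k x * cnj (e n x)))"
      proof (rule summable_comparison_test'[OF summable_mult[OF L1, of B], of 0])
        fix k
        have "(LBINT x. norm (D k x * cnj (e n x))) \<le> (LBINT x. B * norm (D k x))"
          by (intro integral_mono bd integrable_norm integrable_mult_right D_int
              square_integrable_inner_integrable[OF D e])
        then show "norm (LBINT x. norm (D k x * cnj (e n x))) \<le> B * (LBINT x. norm (D k x))"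
          by simp
      qed
    qed
    also have "(LBINT x. (\<Sum>k. D k x * cnj (e n x))) = l2_inner f (e n)"
      unfolding l2_inner_def
    proof (rule integral_cong_AE)
      show "AE x in lborel. (\<Sum>k. D k x * cnj (e n x)) = f x * cnj (e n x)"
        using AE_D
      proof eventually_elim
        case (elim x)
        show ?case unfolding f_def
          by (rule suminf_mult2[symmetric]) (rule summable_norm_cancel[OF elim])
      qed
    qed measurable
    finally have "(\<lambda>k. l2_inner (D k) (e n)) sums l2_inner f (e n)"
      by (simp only: l2_inner_def)
    then have "(\<lambda>K. \<Sum>k<K. l2_inner (D k) (e n)) \<longlonglongrightarrow> l2_inner f (e n)"
      by (simp only: sums_def)
    moreover have "(\<Sum>k<K. l2_inner (D k) (e n)) = c n" if "n < K" for K
    proof -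
      have "(\<Sum>k<K. l2_inner (D k) (e n)) = l2_inner (\<lambda>x. \<Sum>j<r K. c j * e j x) (e n)"
        unfolding D_sum[symmetric] by (rule l2_inner_sum_left[symmetric]) (rule D e)+
      also have "\<dots> = (\<Sum>j<r K. c j * l2_inner (e j) (e n))"
        by (subst l2_inner_sum_left) (simp_all add: e square_integrable_mult_left)
      also have "\<dots> = (\<Sum>j<r K. if j = n then c n else 0)"
        by (intro sum.cong) (auto simp: orth)
      also have "\<dots> = c n"
        using r_ge[of K] that by simp
      finally show ?thesis .
    qed
    then have "(\<lambda>K. \<Sum>k<K. l2_inner (D k) (e n)) \<longlonglongrightarrow> c n"
      by (intro tendsto_eventually eventually_sequentiallyI[of "Suc n"]) simp
    ultimately show ?thesis by (rule LIMSEQ_unique)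
  qed
  then show ?thesis using f f_supp by blast
qed

section \<open>The Fourier transform and translations\<close>

definition ft :: "(real \<Rightarrow> complex) \<Rightarrow> real \<Rightarrow> complex" where
  "ft h \<omega> = (LBINT x. h x * exp (- \<i> * of_real \<omega> * of_real x))"

lemma ft_iexp: "ft h \<omega> = (LBINT x. h x * iexp (- (\<omega> * x)))"
  by (simp add: ft_def mult.assoc)

lemma ft_measurable [measurable]:
  assumes [measurable]: "h \<in> borel_measurable borel"
  shows "ft h \<in> borel_measurable borel"
  unfolding ft_iexp[abs_def] by measurable

lemma integrable_mult_norm_1:
  fixes h u :: "real \<Rightarrow> complex"
  assumes h: "integrable lborel h" and u [measurable]: "u \<in> borel_measurable borel"
    and "\<And>x. norm (u x) \<le> B"
  shows "integrable lborel (\<lambda>x. h x * u x)"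
proof (rule Bochner_Integration.integrable_bound)
  show "integrable lborel (\<lambda>x. B * norm (h x))"
    using h by (intro integrable_mult_right integrable_norm)
  show "(\<lambda>x. h x * u x) \<in> borel_measurable lborel"
    using borel_measurable_integrable[OF h] by measurable
  have "norm (h x * u x) \<le> norm (B * norm (h x))" for x
  proof -
    have "norm (h x * u x) \<le> B * norm (h x)"
      using mult_right_mono[OF assms(3)[of x] norm_ge_zero[of "h x"]] by (simp add: norm_mult mult.commute)
    then show ?thesis by simp
  qed
  then show "AE x in lborel. norm (h x * u x) \<le> norm (B * norm (h x))" by simp
qed

lemma norm_ft_le:
  assumes "integrable lborel h"
  shows "norm (ft h \<omega>) \<le> (LBINT x. norm (h x))"
proof -
  have "norm (ft h \<omega>) \<le> (LBINT x. norm (h x * iexp (- (\<omega> * x))))"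
    unfolding ft_iexp by (rule integral_norm_bound)
  then show ?thesis by (simp add: norm_mult)
qed

lemma ft_diff:
  assumes "integrable lborel h" "integrable lborel k"
  shows "ft (\<lambda>x. h x - k x) \<omega> = ft h \<omega> - ft k \<omega>"
  unfolding ft_iexp
  by (subst Bochner_Integration.integral_diff[symmetric])
    (auto intro!: integrable_mult_norm_1[where B = 1] assms simp: algebra_simps)

lemma cnj_ft: "cnj (ft h \<omega>) = (LBINT y. cnj (h y) * iexp (\<omega> * y))"
proof -
  have "cnj (ft h \<omega>) = (LBINT x. cnj (h x * iexp (- (\<omega> * x))))"
    unfolding ft_iexp by (rule Bochner_Integration.integral_cnj[symmetric])
  then show ?thesis by (simp add: exp_cnj)
qed

lemma prob_space_std_normal: "prob_space std_normal_distribution"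
  by (rule prob_space_normal_density) simp

lemma integral_std_normal_swap:
  fixes h :: "real \<Rightarrow> complex" and H :: "real \<Rightarrow> real \<Rightarrow> complex"
  assumes h: "integrable lborel h"
    and H [measurable]: "(\<lambda>(s, x). H s x) \<in> borel_measurable (borel \<Otimes>\<^sub>M borel)"
    and B: "\<And>s x. norm (H s x) \<le> B"
  shows "(LINT s|std_normal_distribution. (LBINT x. h x * H s x))
    = (LBINT x. h x * (LINT s|std_normal_distribution. H s x))"
proof -
  interpret N: prob_space std_normal_distribution by (rule prob_space_std_normal)
  interpret pair_sigma_finite std_normal_distribution lborel ..
  have [measurable]: "h \<in> borel_measurable borel" using borel_measurable_integrable[OF h] by simp
  have int: "integrable lborel (\<lambda>x. h x * H s x)" for s
    by (rule integrable_mult_norm_1[OF h _ B]) measurable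
  have "integrable (std_normal_distribution \<Otimes>\<^sub>M lborel) (\<lambda>(s, x). h x * H s x)"
  proof (rule Fubini_integrable)
    show "(\<lambda>(s, x). h x * H s x) \<in> borel_measurable (std_normal_distribution \<Otimes>\<^sub>M lborel)"
      by measurable
    show "AE s in std_normal_distribution. integrable lborel (\<lambda>x. case (s, x) of (s, x) \<Rightarrow> h x * H s x)"
      using int by simp
    have "norm (LBINT x. norm (h x * H s x)) \<le> (LBINT x. norm (h x) * B)" for s
    proof -
      have "(LBINT x. norm (h x * H s x)) \<le> (LBINT x. norm (h x) * B)"
        using h int B by (intro integral_mono integrable_norm integrable_mult_left)
          (auto simp: norm_mult intro!: mult_left_mono)
      then show ?thesis by simp
    qed
    then show "integrable std_normal_distribution (\<lambda>s. LBINT x. norm (case (s, x) of (s, x) \<Rightarrow> h x * H s x))"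
      by (intro N.integrable_const_bound[where B = "LBINT x. norm (h x) * B"]) (auto simp: measurable_split_conv)
  qed
  from Fubini_integral[OF this] show ?thesis by simp
qed

lemma square_integrable_translate:
  fixes h :: "real \<Rightarrow> complex"
  assumes h: "square_integrable h"
  shows "square_integrable (\<lambda>x. h (x - u))"
proof -
  have [measurable]: "h \<in> borel_measurable borel" using h by (rule square_integrable_measurable)
  show ?thesis
    using lborel_integrable_real_affine[OF square_integrable_integrable_norm_sq[OF h], of 1 "-u"]
    by (simp add: square_integrable_def)
qed

lemma l2_norm_sq_translate: "l2_norm_sq (\<lambda>x. h (x - u)) = l2_norm_sq h"
  unfolding l2_norm_sq_def
  using lborel_integral_real_affine[of 1 "\<lambda>x. (norm (h x))\<^sup>2" "-u"] by simp

lemma l1_norm_product_le: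
  assumes "square_integrable f" "square_integrable g"
  shows "(LBINT x. norm (f x * cnj (g x))) \<le> l2_norm_sq f + l2_norm_sq g"
proof -
  have "(LBINT x. norm (f x * cnj (g x))) \<le> (LBINT x. (norm (f x))\<^sup>2 + (norm (g x))\<^sup>2)"
  proof (rule integral_mono)
    show "integrable lborel (\<lambda>x. norm (f x * cnj (g x)))"
      by (intro integrable_norm square_integrable_inner_integrable assms)
    show "integrable lborel (\<lambda>x. (norm (f x))\<^sup>2 + (norm (g x))\<^sup>2)"
      by (intro Bochner_Integration.integrable_add square_integrable_integrable_norm_sq assms)
    show "norm (f x * cnj (g x)) \<le> (norm (f x))\<^sup>2 + (norm (g x))\<^sup>2" for x
      using norm_mult_le_squares[of "f x" "cnj (g x)"] by simp
  qed
  then show ?thesis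
    unfolding l2_norm_sq_def
    by (simp only: Bochner_Integration.integral_add[OF square_integrable_integrable_norm_sq[OF assms(1)]
          square_integrable_integrable_norm_sq[OF assms(2)]])
qed

lemma norm_l2_inner_le:
  assumes "square_integrable f" "square_integrable g"
  shows "norm (l2_inner f g) \<le> l2_norm_sq f + l2_norm_sq g"
  unfolding l2_inner_def by (rule order_trans[OF integral_norm_bound l1_norm_product_le[OF assms]])

text \<open>
  For a continuous function cut off to \<open>[-a, a]\<close> this is dominated convergence, the two jumps at
  \<open>\<plusminus>a\<close> being a null set. The general case follows because translation preserves the norm, so that an
  approximation of \<open>h\<close> approximates all translates equally well.
\<close>

lemma l2_translation_continuous:
  fixes h :: "real \<Rightarrow> complex" and u :: "nat \<Rightarrow> real"
  assumes h: "square_integrable h" and supp: "\<And>x. x \<notin> {-a..a} \<Longrightarrow> h x = 0" and u: "u \<longlonglongrightarrow> 0"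
  shows "(\<lambda>n. l2_norm_sq (\<lambda>x. h x - h (x - u n))) \<longlonglongrightarrow> 0"
proof (rule order_tendstoI)
  fix r :: real assume "r < 0"
  then show "\<forall>\<^sub>F n in sequentially. r < l2_norm_sq (\<lambda>x. h x - h (x - u n))"
    by (intro always_eventually allI) (rule order.strict_trans2[OF _ l2_norm_sq_nonneg])
next
  fix r :: real assume r: "0 < r"
  then have "0 < r / 12" by simp
  from continuous_dense[OF h supp this] obtain g where g: "continuous_on UNIV g"
    and hg: "l2_norm_sq (\<lambda>x. h x - indicator {-a..a} x *\<^sub>R g x) < r / 12" by auto
  (* The tolerance r / 12 for h - k enters twice, with the factors 2 and 4 from the two uses of the
     inequality for sums; this leaves r / 2, and four times r / 8 for the translation of k. *)
  define k where "k x = indicator {-a..a} x *\<^sub>R g x" for x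
  have [measurable]: "g \<in> borel_measurable borel" by (rule borel_measurable_continuous_onI[OF g])
  have km [measurable]: "k \<in> borel_measurable borel" unfolding k_def by measurable
  have "bounded (g ` {-a..a})"
    by (intro compact_imp_bounded compact_continuous_image continuous_on_subset[OF g]) auto
  then obtain B where B: "0 < B" "\<forall>x\<in>{-a..a}. norm (g x) \<le> B"
    by (auto simp: bounded_pos)
  have k_le: "norm (k x) \<le> B" for x
    using B by (auto simp: k_def indicator_def)
  have k0: "k x = 0" if "x \<notin> {-a..a}" for x using that by (simp add: k_def)
  have k: "square_integrable k"
    by (rule square_integrable_bounded_support[OF km k_le k0])
  have k_cont: "isCont k x" if "x \<noteq> a" "x \<noteq> -a" for x
  proof (cases "x \<in> {-a<..<a}")
    case True
    have "continuous_on {-a<..<a} k"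
      by (rule continuous_on_eq[OF continuous_on_subset[OF g]]) (auto simp: k_def)
    then show ?thesis using True continuous_on_eq_continuous_at[of "{-a<..<a}" k] by auto
  next
    case False
    have "continuous_on (- {-a..a}) k"
      by (rule continuous_on_eq[of _ "\<lambda>x. 0"]) (auto simp: k_def)
    moreover have "open (- {-a..a})" by (rule open_Compl) simp
    moreover have "x \<in> - {-a..a}" using False that by auto
    ultimately show ?thesis using continuous_on_eq_continuous_at by blast
  qed
  obtain M where M: "0 < M" "\<And>n. \<bar>u n\<bar> \<le> M"
    using convergent_imp_Bseq[OF convergentI[OF u]] by (auto simp: Bseq_def)
  have "(\<lambda>n. l2_norm_sq (\<lambda>x. k (x - u n) - k x)) \<longlonglongrightarrow> 0"
  proof (rule l2_norm_sq_dominated_convergence)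
    have "AE x in lborel. x \<noteq> a \<and> x \<noteq> -a"
      using AE_lborel_singleton[of a] AE_lborel_singleton[of "-a"] by (rule AE_conjI)
    then show "AE x in lborel. (\<lambda>n. k (x - u n)) \<longlonglongrightarrow> k x"
    proof eventually_elim
      case (elim x)
      have "(\<lambda>n. x - u n) \<longlonglongrightarrow> x - 0" by (intro tendsto_intros u)
      then show ?case
        using elim by (intro isCont_tendsto_compose[OF k_cont]) simp_all
    qed
    show "integrable lborel (\<lambda>x. (2 * B)\<^sup>2 * indicator {-a-M..a+M} x)"
      by (intro integrable_mult_right integrable_real_indicator) (simp_all add: emeasure_lborel_Icc_eq)
    fix n x
    show "(norm (k (x - u n) - k x))\<^sup>2 \<le> (2 * B)\<^sup>2 * indicator {-a-M..a+M} x"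
    proof (cases "x \<in> {-a-M..a+M}")
      case True
      have "norm (k (x - u n) - k x) \<le> 2 * B"
        using norm_triangle_ineq4[of "k (x - u n)" "k x"] k_le[of x] k_le[of "x - u n"] by linarith
      then have "(norm (k (x - u n) - k x))\<^sup>2 \<le> (2 * B)\<^sup>2"
        by (rule power_mono) simp
      then show ?thesis using True by simp
    next
      case False
      then have "x \<notin> {-a..a}" "x - u n \<notin> {-a..a}"
        using M(1) M(2)[of n] by auto
      then show ?thesis by (simp add: k0 del: atLeastAtMost_iff)
    qed
  qed measurable
  from order_tendstoD(2)[OF this, of "r / 8"]
  have "\<forall>\<^sub>F n in sequentially. l2_norm_sq (\<lambda>x. k (x - u n) - k x) < r / 8"
    using r by simp
  then show "\<forall>\<^sub>F n in sequentially. l2_norm_sq (\<lambda>x. h x - h (x - u n)) < r"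
  proof eventually_elim
    case (elim n)
    let ?hu = "\<lambda>x. h (x - u n)" and ?ku = "\<lambda>x. k (x - u n)"
    have s: "square_integrable ?hu" "square_integrable ?ku"
      by (rule square_integrable_translate[OF h], rule square_integrable_translate[OF k])
    have 1: "l2_norm_sq (\<lambda>x. h x - k x) < r / 12" using hg by (simp add: k_def)
    have 2: "l2_norm_sq (\<lambda>x. ?ku x - ?hu x) < r / 12"
      using 1 l2_norm_sq_translate[of "\<lambda>x. k x - h x" "u n"] l2_norm_sq_minus_commute[of h k] by simp
    have "l2_norm_sq (\<lambda>x. (h x - k x) + (k x - ?hu x)) \<le> 2 * l2_norm_sq (\<lambda>x. h x - k x) + 2 * l2_norm_sq (\<lambda>x. k x - ?hu x)"
      by (intro l2_norm_sq_add_le square_integrable_diff h k s)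
    moreover have "l2_norm_sq (\<lambda>x. (k x - ?ku x) + (?ku x - ?hu x)) \<le> 2 * l2_norm_sq (\<lambda>x. k x - ?ku x) + 2 * l2_norm_sq (\<lambda>x. ?ku x - ?hu x)"
      by (intro l2_norm_sq_add_le square_integrable_diff h k s)
    moreover have "l2_norm_sq (\<lambda>x. k x - ?ku x) < r / 8"
      using elim l2_norm_sq_minus_commute[of k ?ku] by simp
    ultimately show ?case using 1 2 by simp
  qed
qed

section \<open>Plancherel's theorem for compactly supported functions\<close>

lemma integral_std_normal:
  fixes g :: "real \<Rightarrow> 'b::{banach, second_countable_topology}"
  assumes [measurable]: "g \<in> borel_measurable borel"
  shows "(LINT s|std_normal_distribution. g s) = (LBINT s. std_normal_density s *\<^sub>R g s)"
  by (subst integral_density) auto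

lemma integral_std_normal_iexp:
  "(LINT s|std_normal_distribution. iexp (t * s)) = of_real (exp (- (t\<^sup>2) / 2))"
  using fun_cong[OF char_std_normal_distribution, of t] by (simp add: char_def)

text \<open>
  The Gaussian regularisation behind Plancherel's theorem. Writing the squared modulus of the transform
  as a double integral and averaging over the frequency replaces the exponential by the
  characteristic function of the normal law, which is again a Gaussian in \<open>(x - y) / \<epsilon>\<close>. The substitution
  \<open>y = x - \<epsilon> v\<close> then exhibits an average of the autocorrelation of \<open>h\<close> over shifts of size \<open>\<epsilon>\<close>.
\<close>

lemma gaussian_mean_ft:
  assumes h: "square_integrable h" and supp: "\<And>x. x \<notin> {-a..a} \<Longrightarrow> h x = 0" and \<epsilon>: "0 < \<epsilon>"
  shows "(LINT s|std_normal_distribution. ft h (s / \<epsilon>) * cnj (ft h (s / \<epsilon>)))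
    = of_real (\<epsilon> * sqrt (2 * pi)) * (LINT v|std_normal_distribution. l2_inner h (\<lambda>x. h (x - \<epsilon> * v)))"
proof -
  interpret N: prob_space std_normal_distribution by (rule prob_space_std_normal)
  interpret pair_sigma_finite std_normal_distribution lborel ..
  note [measurable] = square_integrable_measurable[OF h]
  have hi: "integrable lborel h" by (rule square_integrable_imp_integrable[OF h supp])
  let ?B = "LBINT x. norm (h x)"
  have ft_le: "norm (ft h \<omega>) \<le> ?B" for \<omega> by (rule norm_ft_le[OF hi])
  have inner: "(LINT s|std_normal_distribution. iexp (- (s / \<epsilon> * x)) * cnj (ft h (s / \<epsilon>)))
    = of_real (\<epsilon> * sqrt (2 * pi)) * (LINT v|std_normal_distribution. cnj (h (x - \<epsilon> * v)))" for x
  proof -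
    have "(LINT s|std_normal_distribution. iexp (- (s / \<epsilon> * x)) * cnj (ft h (s / \<epsilon>)))
      = (LINT s|std_normal_distribution. (LBINT y. cnj (h y) * iexp ((y - x) / \<epsilon> * s)))"
      unfolding cnj_ft integral_mult_right_zero[symmetric]
      by (intro Bochner_Integration.integral_cong refl)
        (simp add: exp_add[symmetric] algebra_simps diff_divide_distrib)
    also have "\<dots> = (LBINT y. cnj (h y) * (LINT s|std_normal_distribution. iexp ((y - x) / \<epsilon> * s)))"
      by (rule integral_std_normal_swap[where B = 1]) (use hi in \<open>simp_all\<close>)
    also have "\<dots> = (LBINT y. cnj (h y) * of_real (exp (- (((y - x) / \<epsilon>)\<^sup>2) / 2)))"
      unfolding integral_std_normal_iexp ..
    also have "\<dots> = \<epsilon> *\<^sub>R (LBINT v. cnj (h (x - \<epsilon> * v)) * of_real (exp (- (v\<^sup>2) / 2)))"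
      using \<epsilon> by (subst lborel_integral_real_affine[where c = "-\<epsilon>" and t = x]) simp_all
    also have "(LBINT v. cnj (h (x - \<epsilon> * v)) * of_real (exp (- (v\<^sup>2) / 2)))
      = (LBINT v. of_real (sqrt (2 * pi)) * (std_normal_density v *\<^sub>R cnj (h (x - \<epsilon> * v))))"
      by (intro Bochner_Integration.integral_cong refl)
        (simp add: std_normal_density_def scaleR_conv_of_real)
    also have "\<dots> = of_real (sqrt (2 * pi)) * (LINT v|std_normal_distribution. cnj (h (x - \<epsilon> * v)))"
      unfolding integral_mult_right_zero
      by (rule arg_cong[where f = "(*) _"], rule integral_std_normal[symmetric]) measurable
    finally show ?thesis by (simp add: scaleR_conv_of_real)
  qed
  have "(LINT s|std_normal_distribution. ft h (s / \<epsilon>) * cnj (ft h (s / \<epsilon>)))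
      = (LINT s|std_normal_distribution. (LBINT x. h x * (iexp (- (s / \<epsilon> * x)) * cnj (ft h (s / \<epsilon>)))))"
    unfolding mult.assoc[symmetric] integral_mult_left_zero ft_iexp[symmetric] ..
  also have "\<dots> = (LBINT x. h x * (LINT s|std_normal_distribution. iexp (- (s / \<epsilon> * x)) * cnj (ft h (s / \<epsilon>))))"
    by (rule integral_std_normal_swap[OF hi, where B = ?B]) (use ft_le in \<open>simp_all add: norm_mult\<close>)
  also have "\<dots> = of_real (\<epsilon> * sqrt (2 * pi)) *
      (LBINT x. (LINT v|std_normal_distribution. h x * cnj (h (x - \<epsilon> * v))))"
    unfolding inner integral_mult_right_zero[symmetric]
    by (intro Bochner_Integration.integral_cong refl) (simp only: mult_ac)
  also have "(LBINT x. (LINT v|std_normal_distribution. h x * cnj (h (x - \<epsilon> * v))))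
      = (LINT v|std_normal_distribution. l2_inner h (\<lambda>x. h (x - \<epsilon> * v)))"
  proof -
    have "integrable (std_normal_distribution \<Otimes>\<^sub>M lborel) (\<lambda>(v, x). h x * cnj (h (x - \<epsilon> * v)))"
    proof (rule Fubini_integrable)
      show "(\<lambda>(v, x). h x * cnj (h (x - \<epsilon> * v))) \<in> borel_measurable (std_normal_distribution \<Otimes>\<^sub>M lborel)"
        by measurable
      show "AE v in std_normal_distribution. integrable lborel (\<lambda>x. case (v, x) of (v, x) \<Rightarrow> h x * cnj (h (x - \<epsilon> * v)))"
        using square_integrable_inner_integrable[OF h square_integrable_translate[OF h]] by simp
      have "norm (LBINT x. norm (h x * cnj (h (x - \<epsilon> * v)))) \<le> 2 * l2_norm_sq h" for v
        using l1_norm_product_le[OF h square_integrable_translate[OF h], of "\<epsilon> * v"]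
        by (simp add: l2_norm_sq_translate)
      then show "integrable std_normal_distribution (\<lambda>v. LBINT x. norm (case (v, x) of (v, x) \<Rightarrow> h x * cnj (h (x - \<epsilon> * v))))"
        by (intro N.integrable_const_bound[where B = "2 * l2_norm_sq h"]) auto
    qed
    from Fubini_integral[OF this] show ?thesis by (simp add: l2_inner_def)
  qed
  finally show ?thesis .
qed

text \<open>
  The preceding identity after the substitution \<open>s = \<epsilon> t\<close> and with real parts taken; the Gaussian is now
  a weight that increases to \<open>1\<close> as \<open>\<epsilon>\<close> tends to \<open>0\<close>.
\<close>

lemma gaussian_weighted_ft:
  assumes h: "square_integrable h" and supp: "\<And>x. x \<notin> {-a..a} \<Longrightarrow> h x = 0" and \<epsilon>: "0 < \<epsilon>"
  shows "(\<integral>\<^sup>+t. ennreal (exp (- ((\<epsilon> * t)\<^sup>2) / 2) * (norm (ft h t))\<^sup>2) \<partial>lborel)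
    = ennreal (2 * pi * (LINT v|std_normal_distribution. Re (l2_inner h (\<lambda>x. h (x - \<epsilon> * v)))))"
proof -
  interpret N: prob_space std_normal_distribution by (rule prob_space_std_normal)
  note [measurable] = square_integrable_measurable[OF h]
  have hi: "integrable lborel h" by (rule square_integrable_imp_integrable[OF h supp])
  let ?B = "LBINT x. norm (h x)"
  let ?g = "\<lambda>t. exp (- ((\<epsilon> * t)\<^sup>2) / 2) * (norm (ft h t))\<^sup>2"
  have bd: "(norm (ft h t))\<^sup>2 \<le> ?B\<^sup>2" for t
    by (rule power_mono[OF norm_ft_le[OF hi]]) simp
  have gauss: "integrable lborel (\<lambda>t. exp (- ((\<epsilon> * t)\<^sup>2) / 2))"
  proof -
    have "integrable lborel std_normal_density"
      by (rule integrable_normal_density) simp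
    from lborel_integrable_real_affine[OF this, of \<epsilon> 0]
    have "integrable lborel (\<lambda>t. sqrt (2 * pi) * std_normal_density (\<epsilon> * t))"
      using \<epsilon> by (intro integrable_mult_right) simp
    then show ?thesis by (simp add: std_normal_density_def)
  qed
  have int: "integrable lborel ?g"
  proof (rule Bochner_Integration.integrable_bound)
    show "integrable lborel (\<lambda>t. exp (- ((\<epsilon> * t)\<^sup>2) / 2) * ?B\<^sup>2)"
      by (intro integrable_mult_left gauss)
    have "norm (?g t) \<le> norm (exp (- ((\<epsilon> * t)\<^sup>2) / 2) * ?B\<^sup>2)" for t
      using bd[of t] by (simp add: mult_left_mono)
    then show "AE t in lborel. norm (?g t) \<le> norm (exp (- ((\<epsilon> * t)\<^sup>2) / 2) * ?B\<^sup>2)" by simp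
  qed measurable
  have "of_real (LINT s|std_normal_distribution. (norm (ft h (s / \<epsilon>)))\<^sup>2)
      = (LINT s|std_normal_distribution. ft h (s / \<epsilon>) * cnj (ft h (s / \<epsilon>)))"
    by (simp add: complex_norm_square[symmetric] flip: integral_complex_of_real)
  also have "\<dots> = of_real (\<epsilon> * sqrt (2 * pi)) * (LINT v|std_normal_distribution. l2_inner h (\<lambda>x. h (x - \<epsilon> * v)))"
    by (rule gaussian_mean_ft[OF h supp \<epsilon>])
  finally have "Re (of_real (LINT s|std_normal_distribution. (norm (ft h (s / \<epsilon>)))\<^sup>2))
      = Re (of_real (\<epsilon> * sqrt (2 * pi)) * (LINT v|std_normal_distribution. l2_inner h (\<lambda>x. h (x - \<epsilon> * v))))"
    by (rule arg_cong)
  then have "(LINT s|std_normal_distribution. (norm (ft h (s / \<epsilon>)))\<^sup>2)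
      = \<epsilon> * sqrt (2 * pi) * Re (LINT v|std_normal_distribution. l2_inner h (\<lambda>x. h (x - \<epsilon> * v)))"
    by simp
  also have "Re (LINT v|std_normal_distribution. l2_inner h (\<lambda>x. h (x - \<epsilon> * v)))
      = (LINT v|std_normal_distribution. Re (l2_inner h (\<lambda>x. h (x - \<epsilon> * v))))"
  proof (rule integral_Re[symmetric])
    have "norm (l2_inner h (\<lambda>x. h (x - \<epsilon> * v))) \<le> 2 * l2_norm_sq h" for v
      using norm_l2_inner_le[OF h square_integrable_translate[OF h], of "\<epsilon> * v"]
      by (simp add: l2_norm_sq_translate)
    then show "integrable std_normal_distribution (\<lambda>v. l2_inner h (\<lambda>x. h (x - \<epsilon> * v)))"
      unfolding l2_inner_def
      by (intro N.integrable_const_bound[where B = "2 * l2_norm_sq h"]) auto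
  qed
  also have "(LINT s|std_normal_distribution. (norm (ft h (s / \<epsilon>)))\<^sup>2)
      = (LBINT s. std_normal_density s * (norm (ft h (s / \<epsilon>)))\<^sup>2)"
    by (subst integral_std_normal) simp_all
  also have "\<dots> = \<epsilon> * (LBINT t. std_normal_density (\<epsilon> * t) * (norm (ft h t))\<^sup>2)"
    using \<epsilon> by (subst lborel_integral_real_affine[where c = \<epsilon> and t = 0]) simp_all
  also have "(LBINT t. std_normal_density (\<epsilon> * t) * (norm (ft h t))\<^sup>2) = (LBINT t. ?g t) / sqrt (2 * pi)"
    unfolding std_normal_density_def by simp
  finally have "(LBINT t. ?g t) = (sqrt (2 * pi) * sqrt (2 * pi)) *
      (LINT v|std_normal_distribution. Re (l2_inner h (\<lambda>x. h (x - \<epsilon> * v))))"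
    using \<epsilon> by (simp add: field_simps)
  then have "(LBINT t. ?g t) = 2 * pi * (LINT v|std_normal_distribution. Re (l2_inner h (\<lambda>x. h (x - \<epsilon> * v))))"
    by simp
  then show ?thesis
    using nn_integral_eq_integral[OF int] by simp
qed

text \<open>
  Let \<open>\<epsilon>\<close> tend to \<open>0\<close> in \<open>gaussian_weighted_ft\<close>. The left side converges monotonically to the integral
  of the squared transform. On the right the autocorrelation \<open>Re \<langle>h, h(\<cdot> - u)\<rangle> = \<parallel>h\<parallel>\<^sup>2 - \<parallel>h - h(\<cdot> - u)\<parallel>\<^sup>2 / 2\<close>
  tends to \<open>\<parallel>h\<parallel>\<^sup>2\<close> by continuity of translations.
\<close>

lemma plancherel:
  assumes h: "square_integrable h" and supp: "\<And>x. x \<notin> {-a..a} \<Longrightarrow> h x = 0"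
  shows "square_integrable (ft h)" "l2_norm_sq (ft h) = 2 * pi * l2_norm_sq h"
proof -
  interpret N: prob_space std_normal_distribution by (rule prob_space_std_normal)
  note [measurable] = square_integrable_measurable[OF h]
  define \<epsilon> where "\<epsilon> n = 1 / real (Suc n)" for n
  have \<epsilon>_pos: "0 < \<epsilon> n" for n by (simp add: \<epsilon>_def)
  have \<epsilon>_lim: "\<epsilon> \<longlonglongrightarrow> 0" unfolding \<epsilon>_def by (rule LIMSEQ_Suc[OF lim_1_over_n])
  have \<epsilon>_mono: "\<epsilon> n \<le> \<epsilon> m" if "m \<le> n" for m n
    using that unfolding \<epsilon>_def by (intro divide_left_mono) auto
  let ?G = "\<lambda>n t. ennreal (exp (- ((\<epsilon> n * t)\<^sup>2) / 2) * (norm (ft h t))\<^sup>2)"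
  let ?A = "\<lambda>u. Re (l2_inner h (\<lambda>x. h (x - u)))"
  have A: "?A u = l2_norm_sq h - l2_norm_sq (\<lambda>x. h x - h (x - u)) / 2" for u
    using l2_norm_sq_diff[OF h square_integrable_translate[OF h, of u]]
    by (simp add: l2_norm_sq_translate field_simps)
  have A_meas [measurable]: "?A \<in> borel_measurable borel"
    unfolding l2_inner_def by measurable
  have A_bd: "\<bar>?A u\<bar> \<le> 2 * l2_norm_sq h" for u
    using abs_Re_le_cmod[of "l2_inner h (\<lambda>x. h (x - u))"]
      norm_l2_inner_le[OF h square_integrable_translate[OF h], of u]
    by (simp add: l2_norm_sq_translate)
  have "(\<lambda>n. \<integral>\<^sup>+t. ?G n t \<partial>lborel) \<longlonglongrightarrow> (\<integral>\<^sup>+t. ennreal ((norm (ft h t))\<^sup>2) \<partial>lborel)"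
  proof (rule nn_integral_LIMSEQ)
    show "incseq ?G"
    proof (intro incseq_SucI le_funI ennreal_leI mult_right_mono)
      fix n t
      have "(\<epsilon> (Suc n))\<^sup>2 \<le> (\<epsilon> n)\<^sup>2"
        using \<epsilon>_mono[of n "Suc n"] \<epsilon>_pos[of "Suc n"] by (intro power_mono) auto
      then show "exp (- ((\<epsilon> n * t)\<^sup>2) / 2) \<le> exp (- ((\<epsilon> (Suc n) * t)\<^sup>2) / 2)"
        by (simp add: power_mult_distrib mult_right_mono)
    qed simp
    show "(\<lambda>n. ?G n t) \<longlonglongrightarrow> ennreal ((norm (ft h t))\<^sup>2)" for t
    proof (intro tendsto_ennrealI)
      have "(\<lambda>n. exp (- ((\<epsilon> n * t)\<^sup>2) / 2) * (norm (ft h t))\<^sup>2)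
          \<longlonglongrightarrow> exp (- ((0 * t)\<^sup>2) / 2) * (norm (ft h t))\<^sup>2"
        by (intro tendsto_intros \<epsilon>_lim) simp
      then show "(\<lambda>n. exp (- ((\<epsilon> n * t)\<^sup>2) / 2) * (norm (ft h t))\<^sup>2) \<longlonglongrightarrow> (norm (ft h t))\<^sup>2"
        by simp
    qed
  qed measurable
  then have lim1: "(\<lambda>n. ennreal (2 * pi * (LINT v|std_normal_distribution. ?A (\<epsilon> n * v))))
      \<longlonglongrightarrow> (\<integral>\<^sup>+t. ennreal ((norm (ft h t))\<^sup>2) \<partial>lborel)"
    by (simp only: gaussian_weighted_ft[OF h supp \<epsilon>_pos])
  have "(\<lambda>n. LINT v|std_normal_distribution. ?A (\<epsilon> n * v))
      \<longlonglongrightarrow> (LINT v|std_normal_distribution. l2_norm_sq h)"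
  proof (rule integral_dominated_convergence[where w = "\<lambda>v. 2 * l2_norm_sq h"])
    have "(\<lambda>n. ?A (\<epsilon> n * v)) \<longlonglongrightarrow> l2_norm_sq h" for v
    proof -
      have "(\<lambda>n. \<epsilon> n * v) \<longlonglongrightarrow> 0 * v" by (intro tendsto_intros \<epsilon>_lim)
      then have "(\<lambda>n. l2_norm_sq (\<lambda>x. h x - h (x - \<epsilon> n * v))) \<longlonglongrightarrow> 0"
        by (intro l2_translation_continuous[OF h supp]) simp_all
      then have "(\<lambda>n. l2_norm_sq h - l2_norm_sq (\<lambda>x. h x - h (x - \<epsilon> n * v)) / 2) \<longlonglongrightarrow> l2_norm_sq h - 0 / 2"
        by (intro tendsto_intros) simp_all
      then show ?thesis unfolding A by simp
    qed
    then show "AE v in std_normal_distribution. (\<lambda>n. ?A (\<epsilon> n * v)) \<longlonglongrightarrow> l2_norm_sq h" by simp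
    show "AE v in std_normal_distribution. norm (?A (\<epsilon> n * v)) \<le> 2 * l2_norm_sq h" for n
      using A_bd by simp
    show "(\<lambda>v. ?A (\<epsilon> n * v)) \<in> borel_measurable std_normal_distribution" for n
      using measurable_compose[OF _ A_meas, of "\<lambda>v. \<epsilon> n * v" std_normal_distribution] by simp
  qed simp_all
  then have lim: "(\<lambda>n. LINT v|std_normal_distribution. ?A (\<epsilon> n * v)) \<longlonglongrightarrow> l2_norm_sq h"
    using N.prob_space by simp
  have lim2: "(\<lambda>n. ennreal (2 * pi * (LINT v|std_normal_distribution. ?A (\<epsilon> n * v))))
      \<longlonglongrightarrow> ennreal (2 * pi * l2_norm_sq h)"
    by (intro tendsto_ennrealI tendsto_mult_left lim)
  have "(\<integral>\<^sup>+t. ennreal ((norm (ft h t))\<^sup>2) \<partial>lborel) = ennreal (2 * pi * l2_norm_sq h)"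
    by (rule LIMSEQ_unique[OF lim1 lim2])
  then show "square_integrable (ft h)" "l2_norm_sq (ft h) = 2 * pi * l2_norm_sq h"
    by (auto intro!: square_integrableI_nn_integral[of "ft h" "2 * pi * l2_norm_sq h"])
qed

section \<open>Fourier inversion in the square mean\<close>

definition inv_ft :: "(real \<Rightarrow> complex) \<Rightarrow> real \<Rightarrow> complex" where
  "inv_ft \<phi> t = (LBINT \<omega>. \<phi> \<omega> * iexp (t * \<omega>)) / of_real (2 * pi)"

lemma inv_ft_eq_ft: "inv_ft \<phi> t = ft \<phi> (- t) / of_real (2 * pi)"
  by (simp add: inv_ft_def ft_iexp)

text \<open>
  The remainder \<open>e\<^bsup>\<i>h\<omega>\<^esup> - 1 - \<i>h\<omega>\<close> is at most \<open>(a h)\<^sup>2\<close> on the support, so the difference quotient converges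
  with an error that is linear in \<open>h\<close>.
\<close>

lemma inv_ft_has_vector_derivative:
  assumes \<phi>: "integrable lborel \<phi>" and supp: "\<And>\<omega>. \<omega> \<notin> {-a..a} \<Longrightarrow> \<phi> \<omega> = 0"
  shows "(inv_ft \<phi> has_vector_derivative inv_ft (\<lambda>\<omega>. \<i> * of_real \<omega> * \<phi> \<omega>) t) (at t)"
proof -
  have [measurable]: "\<phi> \<in> borel_measurable borel" using borel_measurable_integrable[OF \<phi>] by simp
  define C where "C = a\<^sup>2 * (LBINT \<omega>. norm (\<phi> \<omega>))"
  have C: "0 \<le> C" by (simp add: C_def)
  have sq: "\<bar>\<omega>\<bar>\<^sup>2 \<le> a\<^sup>2" if "\<phi> \<omega> \<noteq> 0" for \<omega>
  proof -
    have "\<omega> \<in> {-a..a}" using supp[of \<omega>] that by blast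
    then have "\<bar>\<omega>\<bar> \<le> a" by (auto simp: abs_le_iff)
    then show ?thesis by (rule power_mono) simp
  qed
  have i1: "integrable lborel (\<lambda>\<omega>. \<phi> \<omega> * iexp (s * \<omega>))" for s
    by (rule integrable_mult_norm_1[OF \<phi>, where B = 1]) simp_all
  have i2: "integrable lborel (\<lambda>\<omega>. \<i> * of_real \<omega> * \<phi> \<omega> * iexp (s * \<omega>))" for s
  proof -
    have "integrable lborel (\<lambda>\<omega>. \<phi> \<omega> * (indicator {-a..a} \<omega> * (\<i> * of_real \<omega> * iexp (s * \<omega>))))"
      by (rule integrable_mult_norm_1[OF \<phi>, where B = "\<bar>a\<bar>"]) (auto simp: norm_mult indicator_def)
    also have "(\<lambda>\<omega>. \<phi> \<omega> * (indicator {-a..a} \<omega> * (\<i> * of_real \<omega> * iexp (s * \<omega>))))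
        = (\<lambda>\<omega>. \<i> * of_real \<omega> * \<phi> \<omega> * iexp (s * \<omega>))"
    proof
      fix \<omega>
      show "\<phi> \<omega> * (indicator {-a..a} \<omega> * (\<i> * of_real \<omega> * iexp (s * \<omega>))) = \<i> * of_real \<omega> * \<phi> \<omega> * iexp (s * \<omega>)"
        using supp[of \<omega>] by (cases "\<omega> \<in> {-a..a}") (simp_all add: mult_ac del: atLeastAtMost_iff)
    qed
    finally show ?thesis .
  qed
  have bound: "norm (inv_ft \<phi> y - inv_ft \<phi> t - (y - t) *\<^sub>R inv_ft (\<lambda>\<omega>. \<i> * of_real \<omega> * \<phi> \<omega>) t) \<le> C * (norm (y - t))\<^sup>2" for y
  proof -
    define h where "h = y - t"
    have "inv_ft \<phi> y - inv_ft \<phi> t - h *\<^sub>R inv_ft (\<lambda>\<omega>. \<i> * of_real \<omega> * \<phi> \<omega>) t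
        = (LBINT \<omega>. \<phi> \<omega> * iexp (y * \<omega>) - \<phi> \<omega> * iexp (t * \<omega>) - of_real h * (\<i> * of_real \<omega> * \<phi> \<omega> * iexp (t * \<omega>))) / of_real (2 * pi)"
      unfolding inv_ft_def using i1 i2
      by (simp add: scaleR_conv_of_real diff_divide_distrib mult.assoc)
    also have "\<dots> = (LBINT \<omega>. \<phi> \<omega> * iexp (t * \<omega>) * (iexp (h * \<omega>) - (\<Sum>k\<le>1. (\<i> * of_real (h * \<omega>)) ^ k / fact k))) / of_real (2 * pi)"
    proof -
      have "y = t + h" by (simp add: h_def)
      then have "iexp (y * \<omega>) = iexp (t * \<omega>) * iexp (h * \<omega>)" for \<omega>
        by (simp add: exp_add[symmetric] algebra_simps)
      then have "\<phi> \<omega> * iexp (y * \<omega>) - \<phi> \<omega> * iexp (t * \<omega>) - of_real h * (\<i> * of_real \<omega> * \<phi> \<omega> * iexp (t * \<omega>))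
         = \<phi> \<omega> * iexp (t * \<omega>) * (iexp (h * \<omega>) - (\<Sum>k\<le>1. (\<i> * of_real (h * \<omega>)) ^ k / fact k))" for \<omega>
        by (simp only:) (simp add: algebra_simps)
      then show ?thesis by (simp only:)
    qed
    also have "norm \<dots> \<le> (LBINT \<omega>. (norm h)\<^sup>2 * a\<^sup>2 * norm (\<phi> \<omega>))"
    proof -
      let ?E = "\<lambda>\<omega>. \<phi> \<omega> * iexp (t * \<omega>) * (iexp (h * \<omega>) - (\<Sum>k\<le>1. (\<i> * of_real (h * \<omega>)) ^ k / fact k))"
      have pt: "norm (?E \<omega>) \<le> (norm h)\<^sup>2 * a\<^sup>2 * norm (\<phi> \<omega>)" for \<omega>
      proof (cases "\<phi> \<omega> = 0")
        case False
        have "norm (iexp (h * \<omega>) - (\<Sum>k\<le>1. (\<i> * of_real (h * \<omega>)) ^ k / fact k)) \<le> \<bar>h * \<omega>\<bar> ^ Suc 1 / fact (Suc 1)"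
          by (rule iexp_approx1)
        also have "\<dots> \<le> \<bar>h * \<omega>\<bar>\<^sup>2"
        proof -
          have "\<bar>z\<bar> ^ Suc 1 / fact (Suc 1) \<le> \<bar>z\<bar>\<^sup>2" for z :: real
            using zero_le_power2[of z] by (simp add: power2_eq_square)
          then show ?thesis .
        qed
        also have "\<dots> \<le> (norm h)\<^sup>2 * a\<^sup>2"
          unfolding abs_mult power_mult_distrib by (simp only: real_norm_def) (intro mult_left_mono sq False, simp)
        finally have "norm (\<phi> \<omega>) * norm (iexp (h * \<omega>) - (\<Sum>k\<le>1. (\<i> * of_real (h * \<omega>)) ^ k / fact k)) \<le> norm (\<phi> \<omega>) * ((norm h)\<^sup>2 * a\<^sup>2)"
          by (rule mult_left_mono) simp
        then show ?thesis unfolding norm_mult by (simp add: mult_ac del: sum.atMost_Suc)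
      qed simp
      have "norm (LBINT \<omega>. ?E \<omega>) \<le> (LBINT \<omega>. norm (?E \<omega>))" by (rule integral_norm_bound)
      also have "\<dots> \<le> (LBINT \<omega>. (norm h)\<^sup>2 * a\<^sup>2 * norm (\<phi> \<omega>))"
      proof (rule integral_mono)
        show r: "integrable lborel (\<lambda>\<omega>. (norm h)\<^sup>2 * a\<^sup>2 * norm (\<phi> \<omega>))"
          by (intro integrable_mult_right integrable_norm \<phi>)
        show "integrable lborel (\<lambda>\<omega>. norm (?E \<omega>))"
        proof (rule Bochner_Integration.integrable_bound[OF r])
          show "AE \<omega> in lborel. norm (norm (?E \<omega>)) \<le> norm ((norm h)\<^sup>2 * a\<^sup>2 * norm (\<phi> \<omega>))"
            using pt by (intro always_eventually allI) (auto simp: abs_mult)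
        qed measurable
      qed (rule pt)
      finally have "norm (LBINT \<omega>. ?E \<omega>) \<le> (LBINT \<omega>. (norm h)\<^sup>2 * a\<^sup>2 * norm (\<phi> \<omega>))" .
      moreover have "norm (z / of_real (2 * pi)) \<le> norm z" for z :: complex
      proof -
        have "norm z * 1 \<le> norm z * (2 * pi)" using pi_ge_two by (intro mult_left_mono) auto
        then show ?thesis by (simp add: norm_divide pos_divide_le_eq)
      qed
      ultimately show ?thesis by (rule order_trans[rotated])
    qed
    also have "\<dots> = C * (norm h)\<^sup>2" by (simp add: C_def)
    finally show ?thesis by (simp add: h_def)
  qed
  show ?thesis
    unfolding has_vector_derivative_def has_derivative_at_alt
  proof (intro conjI allI impI)
    show "bounded_linear (\<lambda>x. x *\<^sub>R inv_ft (\<lambda>\<omega>. \<i> * of_real \<omega> * \<phi> \<omega>) t)"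
      by (rule bounded_linear_scaleR_left)
    fix e :: real assume e: "0 < e"
    show "\<exists>d>0. \<forall>y. norm (y - t) < d \<longrightarrow>
        norm (inv_ft \<phi> y - inv_ft \<phi> t - (y - t) *\<^sub>R inv_ft (\<lambda>\<omega>. \<i> * of_real \<omega> * \<phi> \<omega>) t) \<le> e * norm (y - t)"
    proof (intro exI conjI allI impI)
      show "0 < e / (C + 1)" using e C by simp
      fix y assume y: "norm (y - t) < e / (C + 1)"
      have "C * norm (y - t) \<le> (C + 1) * norm (y - t)" by (rule mult_right_mono) auto
      also have "\<dots> \<le> e" using y C by (simp add: pos_less_divide_eq mult.commute)
      finally have "C * norm (y - t) * norm (y - t) \<le> e * norm (y - t)"
        by (rule mult_right_mono) simp
      then show "norm (inv_ft \<phi> y - inv_ft \<phi> t - (y - t) *\<^sub>R inv_ft (\<lambda>\<omega>. \<i> * of_real \<omega> * \<phi> \<omega>) t) \<le> e * norm (y - t)"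
        using bound[of y] by (simp add: power2_eq_square mult.assoc)
    qed
  qed
qed

lemma inv_ft_plancherel:
  assumes \<phi>: "square_integrable \<phi>" and supp: "\<And>\<omega>. \<omega> \<notin> {-a..a} \<Longrightarrow> \<phi> \<omega> = 0"
  shows "square_integrable (inv_ft \<phi>)" "2 * pi * l2_norm_sq (inv_ft \<phi>) = l2_norm_sq \<phi>"
proof -
  have eq: "inv_ft \<phi> = (\<lambda>t. of_real (1 / (2 * pi)) * ft \<phi> (- t))"
    by (simp add: fun_eq_iff inv_ft_eq_ft)
  have pl: "square_integrable (ft \<phi>)" "l2_norm_sq (ft \<phi>) = 2 * pi * l2_norm_sq \<phi>"
    by (rule plancherel[OF \<phi>], erule supp)+
  have refl: "square_integrable (\<lambda>t. ft \<phi> (- t))"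
    using lborel_integrable_real_affine[OF square_integrable_integrable_norm_sq[OF pl(1)], of "-1" 0]
      square_integrable_measurable[OF pl(1)]
    by (simp add: square_integrable_def)
  then show "square_integrable (inv_ft \<phi>)"
    unfolding eq by (rule square_integrable_mult_left)
  have "l2_norm_sq (\<lambda>t. ft \<phi> (- t)) = l2_norm_sq (ft \<phi>)"
    unfolding l2_norm_sq_def using lborel_integral_real_affine[of "-1" "\<lambda>x. (norm (ft \<phi> x))\<^sup>2" 0] by simp
  then show "2 * pi * l2_norm_sq (inv_ft \<phi>) = l2_norm_sq \<phi>"
    unfolding eq l2_norm_sq_mult by (simp add: pl(2) norm_divide power2_eq_square)
qed

text \<open>
  By Fubini's theorem the forward and the inverse transform are adjoint up to the factor \<open>2\<pi>\<close>.
\<close>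

lemma inner_ft_eq:
  assumes \<phi>: "integrable lborel \<phi>" and k: "integrable lborel k"
  shows "l2_inner \<phi> (ft k) = of_real (2 * pi) * l2_inner (inv_ft \<phi>) k"
proof -
  have [measurable]: "\<phi> \<in> borel_measurable borel" "k \<in> borel_measurable borel"
    using borel_measurable_integrable[OF \<phi>] borel_measurable_integrable[OF k] by simp_all
  have kc: "integrable lborel (\<lambda>t. cnj (k t))" using k by simp
  let ?P = "\<lambda>\<omega> t. \<phi> \<omega> * (cnj (k t) * iexp (\<omega> * t))"
  have "integrable (lborel \<Otimes>\<^sub>M lborel) (\<lambda>(\<omega>, t). ?P \<omega> t)"
  proof (rule lborel_pair.Fubini_integrable)
    show "(\<lambda>(\<omega>, t). ?P \<omega> t) \<in> borel_measurable (lborel \<Otimes>\<^sub>M lborel)" by measurable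
    have "integrable lborel (\<lambda>t. ?P \<omega> t)" for \<omega>
      by (intro integrable_mult_right integrable_mult_norm_1[OF kc, where B = 1]) simp_all
    then show "AE \<omega> in lborel. integrable lborel (\<lambda>t. case (\<omega>, t) of (\<omega>, t) \<Rightarrow> ?P \<omega> t)" by simp
    have "(\<lambda>\<omega>. LBINT t. norm (case (\<omega>, t) of (\<omega>, t) \<Rightarrow> ?P \<omega> t)) = (\<lambda>\<omega>. norm (\<phi> \<omega>) * (LBINT t. norm (k t)))"
      by (simp add: norm_mult)
    then show "integrable lborel (\<lambda>\<omega>. LBINT t. norm (case (\<omega>, t) of (\<omega>, t) \<Rightarrow> ?P \<omega> t))"
      using \<phi> by simp
  qed
  from lborel_pair.Fubini_integral[OF this]
  have "(LBINT t. LBINT \<omega>. ?P \<omega> t) = (LBINT \<omega>. LBINT t. ?P \<omega> t)" by simp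
  also have "\<dots> = l2_inner \<phi> (ft k)"
    unfolding l2_inner_def cnj_ft by (simp only: integral_mult_right_zero)
  also have "(LBINT t. LBINT \<omega>. ?P \<omega> t) = (LBINT t. of_real (2 * pi) * (inv_ft \<phi> t * cnj (k t)))"
  proof (rule Bochner_Integration.integral_cong)
    fix t
    have "(LBINT \<omega>. ?P \<omega> t) = (LBINT \<omega>. cnj (k t) * (\<phi> \<omega> * iexp (t * \<omega>)))"
      by (intro Bochner_Integration.integral_cong refl) (simp add: mult_ac)
    also have "\<dots> = cnj (k t) * (LBINT \<omega>. \<phi> \<omega> * iexp (t * \<omega>))" by (rule integral_mult_right_zero)
    finally show "(LBINT \<omega>. ?P \<omega> t) = of_real (2 * pi) * (inv_ft \<phi> t * cnj (k t))"
      unfolding inv_ft_def by simp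
  qed simp
  finally show ?thesis by (simp add: l2_inner_def)
qed

abbreviation cutoff :: "real \<Rightarrow> (real \<Rightarrow> complex) \<Rightarrow> real \<Rightarrow> complex" where
  "cutoff N f t \<equiv> indicator {-N..N} t *\<^sub>R f t"

lemma cutoff_outside: "t \<notin> {-N..N} \<Longrightarrow> cutoff N f t = 0"
  by simp

lemma square_integrable_cutoff_Icc: "square_integrable f \<Longrightarrow> square_integrable (cutoff N f)"
  by (rule square_integrable_cutoff) simp_all

lemma
  assumes f: "square_integrable f"
  shows integrable_cutoff: "integrable lborel (cutoff N f)"
    and square_integrable_ft_cutoff: "square_integrable (ft (cutoff N f))"
    and l2_norm_sq_ft_cutoff: "l2_norm_sq (ft (cutoff N f)) = 2 * pi * l2_norm_sq (cutoff N f)"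
  by (rule square_integrable_imp_integrable[where a = "-N" and b = N] plancherel[where a = N],
      rule square_integrable_cutoff_Icc[OF f], erule cutoff_outside)+

text \<open>
  Let \<open>k\<close> be the truncation of the inverse transform of \<open>\<phi>\<close>. Both the cross term \<open>\<langle>\<phi>, ft k\<rangle>\<close>, by
  adjointness, and \<open>\<parallel>ft k\<parallel>\<^sup>2\<close>, by Plancherel's identity for \<open>k\<close>, equal \<open>2\<pi> \<parallel>k\<parallel>\<^sup>2\<close>.
\<close>

lemma fourier_truncation_error:
  assumes \<phi>: "square_integrable \<phi>" and supp: "\<And>\<omega>. \<omega> \<notin> {-a..a} \<Longrightarrow> \<phi> \<omega> = 0"
  shows "l2_norm_sq (\<lambda>\<omega>. \<phi> \<omega> - ft (cutoff N (inv_ft \<phi>)) \<omega>)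
    = l2_norm_sq \<phi> - 2 * pi * l2_norm_sq (cutoff N (inv_ft \<phi>))"
proof -
  let ?k = "cutoff N (inv_ft \<phi>)"
  have k: "square_integrable ?k"
    by (rule square_integrable_cutoff_Icc, rule inv_ft_plancherel(1)[OF \<phi>], erule supp)
  have pl: "square_integrable (ft ?k)" "l2_norm_sq (ft ?k) = 2 * pi * l2_norm_sq ?k"
    by (rule square_integrable_ft_cutoff l2_norm_sq_ft_cutoff, rule inv_ft_plancherel(1)[OF \<phi>], erule supp)+
  have int: "integrable lborel \<phi>" "integrable lborel ?k"
    by (rule square_integrable_imp_integrable[OF \<phi>], erule supp)
      (rule square_integrable_imp_integrable[OF k], erule cutoff_outside)
  have "l2_inner (inv_ft \<phi>) ?k = of_real (l2_norm_sq ?k)"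
    unfolding l2_inner_def l2_norm_sq_def integral_complex_of_real[symmetric]
    by (intro Bochner_Integration.integral_cong refl)
      (auto simp: indicator_def complex_norm_square simp flip: of_real_power)
  then have "l2_inner \<phi> (ft ?k) = of_real (2 * pi * l2_norm_sq ?k)"
    unfolding inner_ft_eq[OF int] by simp
  then show ?thesis
    unfolding l2_norm_sq_diff[OF \<phi> pl(1)] pl(2) by simp
qed

lemma l2_norm_sq_cutoff_tendsto:
  assumes f: "square_integrable f"
  shows "((\<lambda>N. l2_norm_sq (cutoff N f)) \<longlongrightarrow> l2_norm_sq f) at_top"
  unfolding l2_norm_sq_def
proof (rule integral_dominated_convergence_at_top[where w = "\<lambda>x. (norm (f x))\<^sup>2"])
  note [measurable] = square_integrable_measurable[OF f]
  show "(\<lambda>x. (norm (f x))\<^sup>2) \<in> borel_measurable lborel" "(\<lambda>x. (norm (cutoff N f x))\<^sup>2) \<in> borel_measurable lborel" for N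
    by measurable
  show "integrable lborel (\<lambda>x. (norm (f x))\<^sup>2)" by (rule square_integrable_integrable_norm_sq[OF f])
  have ev: "\<forall>\<^sub>F N in at_top. (norm (cutoff N f x))\<^sup>2 = (norm (f x))\<^sup>2" for x
    using eventually_ge_at_top[of "\<bar>x\<bar>"] by eventually_elim (auto simp: indicator_def)
  show "AE x in lborel. ((\<lambda>N. (norm (cutoff N f x))\<^sup>2) \<longlongrightarrow> (norm (f x))\<^sup>2) at_top"
    by (intro always_eventually allI tendsto_eventually[OF ev])
  show "\<forall>\<^sub>F N in at_top. AE x in lborel. norm ((norm (cutoff N f x))\<^sup>2) \<le> (norm (f x))\<^sup>2"
    by (intro always_eventually allI) (auto simp: indicator_def)
qed

lemma L2_fourier_iff:
  assumes f: "square_integrable f" and g: "square_integrable g"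
  shows "L2_fourier f g \<longleftrightarrow> ((\<lambda>N. l2_norm_sq (\<lambda>\<omega>. g \<omega> - ft (cutoff N f) \<omega>)) \<longlongrightarrow> 0) at_top"
proof -
  have eq: "(LINT t:{-N..N}|lborel. f t * exp (- \<i> * of_real \<omega> * of_real t)) = ft (cutoff N f) \<omega>" for N \<omega>
    unfolding set_lebesgue_integral_def ft_def by simp
  have "square_integrable (\<lambda>\<omega>. g \<omega> - ft (cutoff N f) \<omega>)" for N
    by (intro square_integrable_diff g square_integrable_ft_cutoff[OF f])
  note nn_integral_norm_sq[OF this]
  then have "L2_fourier f g \<longleftrightarrow> ((\<lambda>N. ennreal (l2_norm_sq (\<lambda>\<omega>. g \<omega> - ft (cutoff N f) \<omega>))) \<longlongrightarrow> ennreal 0) at_top"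
    unfolding L2_fourier_def eq using f g by simp
  also have "\<dots> \<longleftrightarrow> ((\<lambda>N. l2_norm_sq (\<lambda>\<omega>. g \<omega> - ft (cutoff N f) \<omega>)) \<longlongrightarrow> 0) at_top"
    by (rule tendsto_ennreal_iff) simp_all
  finally show ?thesis .
qed

text \<open>
  The truncation error tends to \<open>\<parallel>\<phi>\<parallel>\<^sup>2 - 2\<pi> \<parallel>inv_ft \<phi>\<parallel>\<^sup>2\<close>, which is \<open>0\<close> by Plancherel's identity for \<open>\<phi>\<close>.
\<close>

lemma L2_fourier_inv_ft:
  assumes \<phi>: "square_integrable \<phi>" and supp: "\<And>\<omega>. \<omega> \<notin> {-a..a} \<Longrightarrow> \<phi> \<omega> = 0"
  shows "L2_fourier (inv_ft \<phi>) \<phi>"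
proof -
  have pl: "square_integrable (inv_ft \<phi>)" "2 * pi * l2_norm_sq (inv_ft \<phi>) = l2_norm_sq \<phi>"
    by (rule inv_ft_plancherel[OF \<phi>], erule supp)+
  have err: "l2_norm_sq (\<lambda>\<omega>. \<phi> \<omega> - ft (cutoff N (inv_ft \<phi>)) \<omega>)
      = l2_norm_sq \<phi> - 2 * pi * l2_norm_sq (cutoff N (inv_ft \<phi>))" for N
    by (rule fourier_truncation_error[OF \<phi>], erule supp)
  have "((\<lambda>N. l2_norm_sq \<phi> - 2 * pi * l2_norm_sq (cutoff N (inv_ft \<phi>))) \<longlongrightarrow> l2_norm_sq \<phi> - 2 * pi * l2_norm_sq (inv_ft \<phi>)) at_top"
    by (intro tendsto_intros l2_norm_sq_cutoff_tendsto pl(1))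
  then show ?thesis
    unfolding L2_fourier_iff[OF pl(1) \<phi>] err by (simp add: pl(2))
qed

lemma continuous_AE_zero:
  fixes d :: "real \<Rightarrow> complex"
  assumes "continuous_on UNIV d" "AE x in lborel. d x = 0"
  shows "d x = 0"
proof (rule ccontr)
  assume "d x \<noteq> 0"
  have "open (d -` (- {0}))"
    by (rule open_vimage[OF open_Compl assms(1)]) simp
  moreover have "negligible (d -` (- {0}))"
  proof -
    have "AE x in lebesgue. x \<notin> d -` (- {0})"
      using assms(2) unfolding AE_completion_iff by eventually_elim simp
    moreover have "d -` (- {0}) \<in> sets lebesgue"
      using \<open>open (d -` (- {0}))\<close> by auto
    ultimately show ?thesis
      unfolding negligible_iff_null_sets by (subst AE_iff_null_sets) simp_all
  qed
  ultimately show False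
    using open_not_negligible[of "d -` (- {0})"] \<open>d x \<noteq> 0\<close> by auto
qed

text \<open>
  Plancherel's identity for the truncations bounds the norm of the difference on \<open>[-N, N]\<close> by the two
  truncation errors, both of which vanish in the limit.
\<close>

lemma L2_fourier_unique:
  assumes f: "L2_fourier f \<phi>" and g: "L2_fourier g \<phi>"
    and cont: "continuous_on UNIV f" "continuous_on UNIV g"
  shows "f = g"
proof -
  have sf: "square_integrable f" and sg: "square_integrable g" and s\<phi>: "square_integrable \<phi>"
    using f g by (simp_all add: L2_fourier_def)
  define d where "d x = f x - g x" for x
  have d: "square_integrable d" unfolding d_def by (rule square_integrable_diff[OF sf sg])
  have bound: "2 * pi * l2_norm_sq (cutoff N d) \<le>
      2 * l2_norm_sq (\<lambda>\<omega>. \<phi> \<omega> - ft (cutoff N g) \<omega>) + 2 * l2_norm_sq (\<lambda>\<omega>. \<phi> \<omega> - ft (cutoff N f) \<omega>)" for N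
  proof -
    have "ft (cutoff N d) \<omega> = ft (cutoff N f) \<omega> - ft (cutoff N g) \<omega>" for \<omega>
      unfolding ft_diff[OF integrable_cutoff[OF sf] integrable_cutoff[OF sg], symmetric] d_def by (simp add: scaleR_diff_right)
    then have "ft (cutoff N d) = (\<lambda>\<omega>. (\<phi> \<omega> - ft (cutoff N g) \<omega>) + (ft (cutoff N f) \<omega> - \<phi> \<omega>))"
      by (simp add: fun_eq_iff)
    then have "l2_norm_sq (ft (cutoff N d)) \<le>
      2 * l2_norm_sq (\<lambda>\<omega>. \<phi> \<omega> - ft (cutoff N g) \<omega>) + 2 * l2_norm_sq (\<lambda>\<omega>. ft (cutoff N f) \<omega> - \<phi> \<omega>)"
      by (simp only:) (intro l2_norm_sq_add_le square_integrable_diff s\<phi> square_integrable_ft_cutoff sf sg)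
    then show ?thesis
      unfolding l2_norm_sq_ft_cutoff[OF d] l2_norm_sq_minus_commute[of "ft (cutoff N f)" \<phi>] .
  qed
  have "((\<lambda>N. 2 * l2_norm_sq (\<lambda>\<omega>. \<phi> \<omega> - ft (cutoff N g) \<omega>) + 2 * l2_norm_sq (\<lambda>\<omega>. \<phi> \<omega> - ft (cutoff N f) \<omega>)) \<longlongrightarrow> 2 * 0 + 2 * 0) at_top"
    using f g unfolding L2_fourier_iff[OF sf s\<phi>] L2_fourier_iff[OF sg s\<phi>]
    by (intro tendsto_intros)
  then have major: "((\<lambda>N. 2 * l2_norm_sq (\<lambda>\<omega>. \<phi> \<omega> - ft (cutoff N g) \<omega>) + 2 * l2_norm_sq (\<lambda>\<omega>. \<phi> \<omega> - ft (cutoff N f) \<omega>)) \<longlongrightarrow> 0) at_top"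
    by simp
  have "((\<lambda>N. 2 * pi * l2_norm_sq (cutoff N d)) \<longlongrightarrow> 0) at_top"
    by (rule tendsto_sandwich[OF always_eventually always_eventually tendsto_const major])
      (simp, intro allI bound)
  moreover have "((\<lambda>N. 2 * pi * l2_norm_sq (cutoff N d)) \<longlongrightarrow> 2 * pi * l2_norm_sq d) at_top"
    by (intro tendsto_mult_left l2_norm_sq_cutoff_tendsto d)
  ultimately have "2 * pi * l2_norm_sq d = 0"
    using tendsto_unique[OF trivial_limit_at_top_linorder] by blast
  then have "(LBINT x. (norm (d x))\<^sup>2) = 0" by (simp add: l2_norm_sq_def)
  then have "AE x in lborel. d x = 0"
    using integral_nonneg_eq_0_iff_AE[OF square_integrable_integrable_norm_sq[OF d]] by simp
  moreover have "continuous_on UNIV d" unfolding d_def by (intro continuous_intros cont)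
  ultimately have "d x = 0" for x using continuous_AE_zero by blast
  then show ?thesis by (simp add: d_def fun_eq_iff)
qed

section \<open>Chromatic derivatives\<close>

lemma integrable_power_mult:
  assumes \<phi>: "integrable lborel \<phi>" and supp: "\<And>\<omega>. \<omega> \<notin> {-a..a} \<Longrightarrow> \<phi> \<omega> = 0"
  shows "integrable lborel (\<lambda>\<omega>. (\<i> * of_real \<omega>) ^ k * \<phi> \<omega>)"
proof -
  have "integrable lborel (\<lambda>\<omega>. \<phi> \<omega> * (indicator {-a..a} \<omega> * (\<i> * of_real \<omega>) ^ k))"
    by (rule integrable_mult_norm_1[OF \<phi>, where B = "\<bar>a\<bar> ^ k"])
      (auto simp: norm_mult norm_power indicator_def intro!: power_mono)
  also have "(\<lambda>\<omega>. \<phi> \<omega> * (indicator {-a..a} \<omega> * (\<i> * of_real \<omega>) ^ k)) = (\<lambda>\<omega>. (\<i> * of_real \<omega>) ^ k * \<phi> \<omega>)"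
  proof
    fix \<omega>
    show "\<phi> \<omega> * (indicator {-a..a} \<omega> * (\<i> * of_real \<omega>) ^ k) = (\<i> * of_real \<omega>) ^ k * \<phi> \<omega>"
      using supp[of \<omega>] by (cases "\<omega> \<in> {-a..a}") (simp_all add: mult_ac del: atLeastAtMost_iff)
  qed
  finally show ?thesis .
qed

text \<open>
  The exponential series may be integrated termwise, since it is dominated on the support by the
  series of \<open>e\<^bsup>\<bar>t\<bar>\<bar>a\<bar>\<^esup>\<close>.
\<close>

lemma inv_ft_power_series:
  assumes \<phi>: "integrable lborel \<phi>" and supp: "\<And>\<omega>. \<omega> \<notin> {-a..a} \<Longrightarrow> \<phi> \<omega> = 0"
  shows "(\<lambda>k. inv_ft (\<lambda>\<omega>. (\<i> * of_real \<omega>) ^ k * \<phi> \<omega>) 0 / fact k * of_real t ^ k) sums inv_ft \<phi> t"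
proof -
  have [measurable]: "\<phi> \<in> borel_measurable borel" using borel_measurable_integrable[OF \<phi>] by simp
  let ?D = "\<lambda>k \<omega>. (of_real t ^ k / fact k) * ((\<i> * of_real \<omega>) ^ k * \<phi> \<omega>)"
  have Dint: "integrable lborel (?D k)" for k
    by (intro integrable_mult_right integrable_power_mult[OF \<phi>, of a]) (erule supp)
  have bd: "norm (?D k \<omega>) \<le> (\<bar>t\<bar> * \<bar>a\<bar>) ^ k / fact k * norm (\<phi> \<omega>)" for k \<omega>
  proof (cases "\<omega> \<in> {-a..a}")
    case True
    then have "\<bar>\<omega>\<bar> ^ k \<le> \<bar>a\<bar> ^ k" by (intro power_mono) auto
    then have "\<bar>t\<bar> ^ k / fact k * (\<bar>\<omega>\<bar> ^ k * norm (\<phi> \<omega>)) \<le> \<bar>t\<bar> ^ k / fact k * (\<bar>a\<bar> ^ k * norm (\<phi> \<omega>))"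
      by (intro mult_left_mono mult_right_mono) auto
    then show ?thesis by (simp add: norm_mult norm_divide norm_power power_mult_distrib)
  next
    case False
    then show ?thesis using supp[OF False] by simp
  qed
  have exp_sum: "summable (\<lambda>k. (\<bar>t\<bar> * \<bar>a\<bar>) ^ k / fact k)"
    using summable_exp[of "\<bar>t\<bar> * \<bar>a\<bar>"] by (simp add: field_simps)
  have D_sums: "(\<lambda>k. ?D k \<omega>) sums (\<phi> \<omega> * iexp (t * \<omega>))" for \<omega>
  proof -
    have "(\<lambda>k. (\<i> * of_real (t * \<omega>)) ^ k /\<^sub>R fact k * \<phi> \<omega>) sums (iexp (t * \<omega>) * \<phi> \<omega>)"
      by (intro sums_mult2 exp_converges)
    then show ?thesis
      by (simp add: scaleR_conv_of_real power_mult_distrib field_simps)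
  qed
  have "(\<lambda>k. integral\<^sup>L lborel (?D k)) sums (LBINT \<omega>. (\<Sum>k. ?D k \<omega>))"
  proof (rule sums_integral[OF Dint])
    show "AE \<omega> in lborel. summable (\<lambda>k. norm (?D k \<omega>))"
      by (intro always_eventually allI summable_comparison_test'[OF summable_mult2[OF exp_sum], of 0])
        (use bd in auto)
    show "summable (\<lambda>k. LBINT \<omega>. norm (?D k \<omega>))"
    proof (rule summable_comparison_test'[OF summable_mult2[OF exp_sum], of 0])
      fix k
      have "(LBINT \<omega>. norm (?D k \<omega>)) \<le> (LBINT \<omega>. (\<bar>t\<bar> * \<bar>a\<bar>) ^ k / fact k * norm (\<phi> \<omega>))"
        by (intro integral_mono bd integrable_norm Dint integrable_mult_right \<phi>)
      then show "norm (LBINT \<omega>. norm (?D k \<omega>)) \<le> (\<bar>t\<bar> * \<bar>a\<bar>) ^ k / fact k * (LBINT \<omega>. norm (\<phi> \<omega>))"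
        by simp
    qed
  qed
  also have "(LBINT \<omega>. (\<Sum>k. ?D k \<omega>)) = (LBINT \<omega>. \<phi> \<omega> * iexp (t * \<omega>))"
    unfolding sums_unique[OF D_sums, symmetric] ..
  finally have "(\<lambda>k. integral\<^sup>L lborel (?D k) / of_real (2 * pi)) sums inv_ft \<phi> t"
    unfolding inv_ft_def by (rule sums_divide)
  moreover have "integral\<^sup>L lborel (?D k) / of_real (2 * pi)
      = inv_ft (\<lambda>\<omega>. (\<i> * of_real \<omega>) ^ k * \<phi> \<omega>) 0 / fact k * of_real t ^ k" for k
    unfolding integral_mult_right_zero inv_ft_def by (simp add: mult_ac)
  ultimately show ?thesis by simp
qed

text \<open>
  The derivative of an entire function along the real axis is its complex derivative; if the values
  there are real, so are those of the derivative, and the argument can be iterated.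
\<close>

lemma real_restriction_higher_deriv:
  fixes f :: "real \<Rightarrow> real"
  assumes F: "F holomorphic_on UNIV" and eq: "\<And>t. F (of_real t) = of_real (f t)"
  shows "(deriv ^^ k) F (of_real t) = of_real ((deriv ^^ k) f t)"
    and "((deriv ^^ k) f has_real_derivative (deriv ^^ Suc k) f t) (at t)"
proof -
  have step: "(g has_real_derivative deriv g t) (at t) \<and> deriv G (of_real t) = of_real (deriv g t)"
    if G: "G holomorphic_on UNIV" and gG: "\<And>t. G (of_real t) = of_real (g t)" for G and g :: "real \<Rightarrow> real" and t
  proof -
    have "(G has_field_derivative deriv G (of_real t)) (at (of_real t))"
      by (rule holomorphic_derivI[OF G]) auto
    then have vd: "((\<lambda>s. complex_of_real (g s)) has_vector_derivative deriv G (of_real t)) (at t)"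
      using has_vector_derivative_real_field[of G _ t UNIV] by (simp add: gG)
    have "(g has_vector_derivative Re (deriv G (of_real t))) (at t)"
      using bounded_linear.has_vector_derivative[OF bounded_linear_Re vd] by simp
    then have re: "(g has_real_derivative Re (deriv G (of_real t))) (at t)"
      by (simp add: has_real_derivative_iff_has_vector_derivative)
    have "((\<lambda>s. 0 :: real) has_vector_derivative Im (deriv G (of_real t))) (at t)"
      using bounded_linear.has_vector_derivative[OF bounded_linear_Im vd] by simp
    then have "Im (deriv G (of_real t)) = 0"
      using vector_derivative_unique_at has_vector_derivative_const by metis
    then show ?thesis
      using re DERIV_imp_deriv[OF re] by (simp add: complex_eq_iff)
  qed
  have main: "(deriv ^^ k) F (of_real s) = of_real ((deriv ^^ k) f s)" for k s
  proof (induction k arbitrary: s)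
    case (Suc k)
    show ?case using step[OF holomorphic_higher_deriv[OF F open_UNIV, of k] Suc] by simp
  qed (simp add: eq)
  then show "(deriv ^^ k) F (of_real t) = of_real ((deriv ^^ k) f t)" .
  show "((deriv ^^ k) f has_real_derivative (deriv ^^ Suc k) f t) (at t)"
    using step[OF holomorphic_higher_deriv[OF F open_UNIV, of k] main] by simp
qed

lemma higher_deriv_inv_ft:
  fixes f :: "real \<Rightarrow> real"
  assumes F: "F holomorphic_on UNIV" and eq: "\<And>t. F (of_real t) = of_real (f t)"
    and \<phi>: "integrable lborel \<phi>" and supp: "\<And>\<omega>. \<omega> \<notin> {-a..a} \<Longrightarrow> \<phi> \<omega> = 0"
    and f: "\<And>t. of_real (f t) = inv_ft \<phi> t"
  shows "of_real ((deriv ^^ k) f t) = inv_ft (\<lambda>\<omega>. (\<i> * of_real \<omega>) ^ k * \<phi> \<omega>) t"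
proof (induction k arbitrary: t)
  case (Suc k)
  let ?\<phi> = "\<lambda>\<omega>. (\<i> * of_real \<omega>) ^ k * \<phi> \<omega>"
  have "integrable lborel ?\<phi>" by (rule integrable_power_mult[OF \<phi>, of a]) (erule supp)
  then have "(inv_ft ?\<phi> has_vector_derivative inv_ft (\<lambda>\<omega>. \<i> * of_real \<omega> * ?\<phi> \<omega>) t) (at t)"
    by (rule inv_ft_has_vector_derivative[where a = a]) (simp add: supp del: atLeastAtMost_iff)
  moreover have "inv_ft ?\<phi> = (\<lambda>t. of_real ((deriv ^^ k) f t))"
    using Suc by (simp add: fun_eq_iff)
  ultimately have "((\<lambda>t. complex_of_real ((deriv ^^ k) f t)) has_vector_derivative inv_ft (\<lambda>\<omega>. \<i> * of_real \<omega> * ?\<phi> \<omega>) t) (at t)"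
    by simp
  moreover have "((\<lambda>t. complex_of_real ((deriv ^^ k) f t)) has_vector_derivative of_real ((deriv ^^ Suc k) f t)) (at t)"
    using real_restriction_higher_deriv(2)[OF F eq, of k t]
    by (intro has_vector_derivative_of_real) (simp only: has_real_derivative_iff_has_vector_derivative)
  ultimately have "inv_ft (\<lambda>\<omega>. \<i> * of_real \<omega> * ?\<phi> \<omega>) t = of_real ((deriv ^^ Suc k) f t)"
    by (rule vector_derivative_unique_at)
  then show ?case by (simp add: mult.assoc)
qed (simp add: f)

text \<open>
  On \<open>e\<^bsup>\<i>\<omega>t\<^esup>\<close> the operator \<open>-\<i> d/dt\<close> acts as multiplication by \<open>\<omega>\<close>, so the \<open>n\<close>-th chromatic derivative acts as
  multiplication by \<open>\<i>\<^sup>n p\<^sub>n(\<omega>)\<close>. The factor \<open>1/\<surd>(2\<pi>)\<close> comes from the two normalisations, \<open>1/(2\<pi>)\<close> in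
  \<open>inv_ft\<close> and \<open>1/\<surd>(2\<pi>)\<close> in \<open>legendre_fn\<close>. The combination is stated for moments of \<open>\<phi>\<close> rather than for
  derivatives of a function, so that it also applies before \<open>inv_ft \<phi>\<close> is known to equal \<open>f\<close>.
\<close>

lemma chromatic_combination_inv_ft:
  assumes \<phi>: "integrable lborel \<phi>" and supp: "\<And>\<omega>. \<omega> \<notin> {-pi..pi} \<Longrightarrow> \<phi> \<omega> = 0"
  shows "(\<Sum>k\<le>degree (legendre_pi n). of_real (chromatic_coeff n k) * inv_ft (\<lambda>\<omega>. (\<i> * of_real \<omega>) ^ k * \<phi> \<omega>) t)
    = \<i> ^ n / of_real (sqrt (2 * pi)) * l2_inner (\<lambda>\<omega>. \<phi> \<omega> * iexp (t * \<omega>)) (legendre_fn n)"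
proof -
  have int: "integrable lborel (\<lambda>\<omega>. (\<i> * of_real \<omega>) ^ k * \<phi> \<omega> * iexp (t * \<omega>))" for k
    by (rule integrable_mult_norm_1[where B = 1], rule integrable_power_mult[OF \<phi>, of pi], erule supp) simp_all
  have "(\<Sum>k\<le>degree (legendre_pi n). of_real (chromatic_coeff n k) * inv_ft (\<lambda>\<omega>. (\<i> * of_real \<omega>) ^ k * \<phi> \<omega>) t)
    = (\<Sum>k\<le>degree (legendre_pi n). (LBINT \<omega>. of_real (chromatic_coeff n k) * ((\<i> * of_real \<omega>) ^ k * \<phi> \<omega> * iexp (t * \<omega>)))) / of_real (2 * pi)"
    unfolding inv_ft_def integral_mult_right_zero sum_divide_distrib by simp
  also have "\<dots> = (LBINT \<omega>. (\<Sum>k\<le>degree (legendre_pi n). of_real (chromatic_coeff n k) * ((\<i> * of_real \<omega>) ^ k * \<phi> \<omega> * iexp (t * \<omega>)))) / of_real (2 * pi)"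
    by (rule arg_cong2[where f = "(/)"], rule Bochner_Integration.integral_sum[symmetric],
      intro integrable_mult_right int) (rule refl)
  also have "\<dots> = (LBINT \<omega>. (\<i> ^ n * of_real (sqrt (2 * pi))) * (\<phi> \<omega> * iexp (t * \<omega>) * cnj (legendre_fn n \<omega>))) / of_real (2 * pi)"
  proof (intro arg_cong2[where f = "(/)"] Bochner_Integration.integral_cong refl)
    fix \<omega> :: real
    have "(\<Sum>k\<le>degree (legendre_pi n). of_real (chromatic_coeff n k) * (\<i> * of_real \<omega>) ^ k)
      = (\<Sum>k\<le>degree (legendre_pi n). \<i> ^ n * of_real (coeff (legendre_pi n) k * \<omega> ^ k))"
    proof (rule sum.cong[OF refl])
      fix k
      have "(- \<i>) ^ k * (\<i> * of_real \<omega>) ^ k = of_real \<omega> ^ k"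
        by (simp flip: power_mult_distrib)
      then show "of_real (chromatic_coeff n k) * (\<i> * of_real \<omega>) ^ k = \<i> ^ n * of_real (coeff (legendre_pi n) k * \<omega> ^ k)"
        unfolding chromatic_coeff_complex by (simp only: mult.assoc of_real_mult of_real_power)
    qed
    also have "\<dots> = \<i> ^ n * of_real (poly (legendre_pi n) \<omega>)"
      by (simp add: poly_altdef sum_distrib_left)
    finally have "(\<Sum>k\<le>degree (legendre_pi n). of_real (chromatic_coeff n k) * ((\<i> * of_real \<omega>) ^ k * \<phi> \<omega> * iexp (t * \<omega>)))
       = \<i> ^ n * of_real (poly (legendre_pi n) \<omega>) * (\<phi> \<omega> * iexp (t * \<omega>))"
      by (simp only: mult.assoc[symmetric] sum_distrib_right[symmetric])
    also have "\<dots> = (\<i> ^ n * of_real (sqrt (2 * pi))) * (\<phi> \<omega> * iexp (t * \<omega>) * cnj (legendre_fn n \<omega>))"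
    proof (cases "\<omega> \<in> {-pi..pi}")
      case True
      then show ?thesis by (simp add: legendre_fn_def)
    next
      case False
      then show ?thesis using supp[OF False] by simp
    qed
    finally show "(\<Sum>k\<le>degree (legendre_pi n). of_real (chromatic_coeff n k) * ((\<i> * of_real \<omega>) ^ k * \<phi> \<omega> * iexp (t * \<omega>)))
       = (\<i> ^ n * of_real (sqrt (2 * pi))) * (\<phi> \<omega> * iexp (t * \<omega>) * cnj (legendre_fn n \<omega>))" .
  qed
  also have "\<dots> = \<i> ^ n * (of_real (sqrt (2 * pi)) / of_real (2 * pi)) * l2_inner (\<lambda>\<omega>. \<phi> \<omega> * iexp (t * \<omega>)) (legendre_fn n)"
    unfolding integral_mult_right_zero l2_inner_def by simp
  also have "complex_of_real (sqrt (2 * pi)) / of_real (2 * pi) = 1 / of_real (sqrt (2 * pi))"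
  proof -
    have "sqrt (2 * pi) / (2 * pi) = 1 / sqrt (2 * pi)"
      by (simp add: field_simps)
    then show ?thesis by (metis of_real_1 of_real_divide)
  qed
  finally show ?thesis by simp
qed

lemma chromatic_deriv_inv_ft:
  fixes f :: "real \<Rightarrow> real"
  assumes F: "F holomorphic_on UNIV" and eq: "\<And>t. F (of_real t) = of_real (f t)"
    and \<phi>: "integrable lborel \<phi>" and supp: "\<And>\<omega>. \<omega> \<notin> {-pi..pi} \<Longrightarrow> \<phi> \<omega> = 0"
    and f: "\<And>t. of_real (f t) = inv_ft \<phi> t"
  shows "of_real (chromatic_deriv n f t)
    = \<i> ^ n / of_real (sqrt (2 * pi)) * l2_inner (\<lambda>\<omega>. \<phi> \<omega> * iexp (t * \<omega>)) (legendre_fn n)"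
proof -
  have "of_real (chromatic_deriv n f t) = (\<Sum>k\<le>degree (legendre_pi n).
      of_real (chromatic_coeff n k) * complex_of_real ((deriv ^^ k) f t))"
    by (simp add: chromatic_deriv_def)
  also have "\<dots> = (\<Sum>k\<le>degree (legendre_pi n).
      of_real (chromatic_coeff n k) * inv_ft (\<lambda>\<omega>. (\<i> * of_real \<omega>) ^ k * \<phi> \<omega>) t)"
    by (intro sum.cong refl arg_cong[where f = "(*) _"] higher_deriv_inv_ft[OF F eq \<phi> _ f, of pi]) (erule supp)
  also have "\<dots> = \<i> ^ n / of_real (sqrt (2 * pi)) * l2_inner (\<lambda>\<omega>. \<phi> \<omega> * iexp (t * \<omega>)) (legendre_fn n)"
    by (rule chromatic_combination_inv_ft[OF \<phi>]) (erule supp)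
  finally show ?thesis .
qed

text \<open>
  Parseval's identity for \<open>\<phi>(\<omega>) e\<^bsup>\<i>\<omega>t\<^esup>\<close>, whose norm is that of \<open>\<phi>\<close> whatever \<open>t\<close> is.
\<close>

lemma chromatic_energy:
  fixes f :: "real \<Rightarrow> real"
  assumes F: "F holomorphic_on UNIV" and eq: "\<And>t. F (of_real t) = of_real (f t)"
    and \<phi>: "square_integrable \<phi>" and supp: "\<And>\<omega>. \<omega> \<notin> {-pi..pi} \<Longrightarrow> \<phi> \<omega> = 0"
    and f: "\<And>t. of_real (f t) = inv_ft \<phi> t"
  shows "(\<lambda>n. (chromatic_deriv n f t)\<^sup>2) sums (l2_norm_sq \<phi> / (2 * pi))"
proof -
  let ?\<psi> = "\<lambda>\<omega>. \<phi> \<omega> * iexp (t * \<omega>)"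
  have int: "integrable lborel \<phi>" by (rule square_integrable_imp_integrable[OF \<phi>]) (erule supp)
  have \<psi>: "square_integrable ?\<psi>"
    using square_integrable_mult_bounded[OF \<phi>, of "\<lambda>\<omega>. iexp (t * \<omega>)" 1] by (simp add: mult.commute)
  have "(\<lambda>n. (norm (l2_inner ?\<psi> (legendre_fn n)))\<^sup>2 / (2 * pi)) sums (l2_norm_sq ?\<psi> / (2 * pi))"
    by (intro sums_divide legendre_parseval \<psi>) (simp add: supp del: atLeastAtMost_iff)
  moreover have "l2_norm_sq ?\<psi> = l2_norm_sq \<phi>"
    by (simp add: l2_norm_sq_def norm_mult)
  moreover have "(norm (l2_inner ?\<psi> (legendre_fn n)))\<^sup>2 / (2 * pi) = (chromatic_deriv n f t)\<^sup>2" for n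
  proof -
    have "\<bar>chromatic_deriv n f t\<bar> = norm (complex_of_real (chromatic_deriv n f t))" by simp
    also have "complex_of_real (chromatic_deriv n f t) = \<i> ^ n / of_real (sqrt (2 * pi)) * l2_inner ?\<psi> (legendre_fn n)"
      by (rule chromatic_deriv_inv_ft[OF F eq int _ f]) (erule supp)
    also have "norm \<dots> = norm (l2_inner ?\<psi> (legendre_fn n)) / sqrt (2 * pi)"
      by (simp add: norm_mult norm_divide norm_power)
    finally have "\<bar>chromatic_deriv n f t\<bar>\<^sup>2 = (norm (l2_inner ?\<psi> (legendre_fn n)) / sqrt (2 * pi))\<^sup>2" by simp
    then show ?thesis by (simp add: power_divide)
  qed
  ultimately show ?thesis by simp
qed

text \<open>
  The transform is first changed on a null set to vanish outside \<open>[-a, a]\<close> everywhere. Its inverse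
  transform is a continuous function with the same transform as \<open>f\<close>.
\<close>

lemma BL_imp_inv_ft:
  assumes f: "f \<in> BL a"
  shows "\<exists>\<phi>. square_integrable \<phi> \<and> (\<forall>\<omega>. \<omega> \<notin> {-a..a} \<longrightarrow> \<phi> \<omega> = 0) \<and> (\<forall>t. of_real (f t) = inv_ft \<phi> t)"
proof -
  obtain g where cont: "continuous_on UNIV f" and g: "L2_fourier (\<lambda>t. complex_of_real (f t)) g"
    and AE: "AE \<omega> in lborel. \<omega> \<notin> {-a..a} \<longrightarrow> g \<omega> = 0"
    using f by (auto simp: BL_def)
  let ?\<phi> = "cutoff a g"
  have sg: "square_integrable g" using g by (simp add: L2_fourier_def)
  have \<phi>: "square_integrable ?\<phi>" by (rule square_integrable_cutoff_Icc[OF sg])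
  have AE_eq: "AE \<omega> in lborel. g \<omega> = ?\<phi> \<omega>"
    using AE by eventually_elim (auto simp: indicator_def)
  have "(\<integral>\<^sup>+\<omega>. ennreal ((norm (g \<omega> - u \<omega>))\<^sup>2) \<partial>lborel) = (\<integral>\<^sup>+\<omega>. ennreal ((norm (?\<phi> \<omega> - u \<omega>))\<^sup>2) \<partial>lborel)" for u
  proof (rule nn_integral_cong_AE)
    show "AE \<omega> in lborel. ennreal ((norm (g \<omega> - u \<omega>))\<^sup>2) = ennreal ((norm (?\<phi> \<omega> - u \<omega>))\<^sup>2)"
      using AE_eq by eventually_elim simp
  qed
  then have f\<phi>: "L2_fourier (\<lambda>t. complex_of_real (f t)) ?\<phi>"
    using g \<phi> by (simp add: L2_fourier_def)
  have int: "integrable lborel ?\<phi>" by (rule integrable_cutoff[OF sg])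
  have "(\<lambda>t. complex_of_real (f t)) = inv_ft ?\<phi>"
  proof (rule L2_fourier_unique[OF f\<phi>])
    show "L2_fourier (inv_ft ?\<phi>) ?\<phi>"
      by (rule L2_fourier_inv_ft[OF \<phi>]) (erule cutoff_outside)
    show "continuous_on UNIV (\<lambda>t. complex_of_real (f t))" by (intro continuous_intros cont)
    have "isCont (inv_ft ?\<phi>) t" for t
      by (rule has_vector_derivative_continuous, rule inv_ft_has_vector_derivative[OF int], erule cutoff_outside)
    then show "continuous_on UNIV (inv_ft ?\<phi>)" by (simp add: continuous_at_imp_continuous_on)
  qed
  then show ?thesis using \<phi> by (intro exI[of _ ?\<phi>]) (auto simp: fun_eq_iff)
qed

lemma inv_ft_imp_BL:
  fixes f :: "real \<Rightarrow> real"
  assumes cont: "continuous_on UNIV f"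
    and \<phi>: "square_integrable \<phi>" and supp: "\<And>\<omega>. \<omega> \<notin> {-a..a} \<Longrightarrow> \<phi> \<omega> = 0"
    and f: "\<And>t. of_real (f t) = inv_ft \<phi> t"
  shows "f \<in> BL a"
proof -
  have eq: "(\<lambda>t. complex_of_real (f t)) = inv_ft \<phi>" using f by (simp add: fun_eq_iff)
  have "L2_fourier (\<lambda>t. complex_of_real (f t)) \<phi>"
    unfolding eq by (rule L2_fourier_inv_ft[OF \<phi>]) (erule supp)
  moreover from this have "square_integrable f"
    using borel_measurable_continuous_onI[OF cont] by (simp add: L2_fourier_def square_integrable_def)
  ultimately show ?thesis
    using cont supp unfolding BL_def by blast
qed

lemma chromatic_coeff_top_nonzero: "chromatic_coeff n n \<noteq> 0"
proof
  assume "chromatic_coeff n n = 0"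
  then have "\<i> ^ n * complex_of_real (coeff (legendre_pi n) n) * (- \<i>) ^ n = 0"
    using chromatic_coeff_complex[of n n] by simp
  then have "coeff (legendre_pi n) n = 0" by simp
  then have "legendre_pi n = 0"
    using degree_legendre_pi[of n] leading_coeff_0_iff by metis
  then show False
    using legendre_fn_orthonormal[of n n] by (simp add: legendre_fn_def[abs_def] l2_inner_def)
qed

text \<open>
  The factor \<open>(-\<i>)\<^sup>n\<close> in the prescribed coefficients cancels the \<open>\<i>\<^sup>n\<close> of the chromatic derivatives, so that
  \<open>inv_ft \<phi>\<close> and \<open>f\<close> have the same chromatic derivatives at \<open>0\<close>. The coefficients of these form a
  triangular array with nonzero diagonal, which makes the ordinary derivatives agree as well.
\<close>

lemma summable_imp_inv_ft:
  fixes f :: "real \<Rightarrow> real"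
  assumes F: "F holomorphic_on UNIV" and eq: "\<And>t. F (of_real t) = of_real (f t)"
    and sum: "summable (\<lambda>n. (chromatic_deriv n f 0)\<^sup>2)"
  shows "\<exists>\<phi>. square_integrable \<phi> \<and> (\<forall>\<omega>. \<omega> \<notin> {-pi..pi} \<longrightarrow> \<phi> \<omega> = 0) \<and> (\<forall>t. of_real (f t) = inv_ft \<phi> t)"
proof -
  define c where "c n = of_real (sqrt (2 * pi)) * (- \<i>) ^ n * complex_of_real (chromatic_deriv n f 0)" for n
  have "(norm (c n))\<^sup>2 = 2 * pi * (chromatic_deriv n f 0)\<^sup>2" for n
    by (simp add: c_def norm_mult norm_power power_mult_distrib)
  then have "summable (\<lambda>n. (norm (c n))\<^sup>2)"
    using summable_mult[OF sum, of "2 * pi"] by simp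
  from riesz_fischer[of legendre_fn pi c, OF square_integrable_legendre_fn legendre_fn_orthonormal _ pi_gt_zero legendre_fn_bounded this]
  obtain \<phi> where \<phi>: "square_integrable \<phi>" and supp: "\<And>\<omega>. \<omega> \<notin> {-pi..pi} \<Longrightarrow> \<phi> \<omega> = 0"
    and coeff: "\<And>n. l2_inner \<phi> (legendre_fn n) = c n"
    by (auto simp: legendre_fn_def)
  have int: "integrable lborel \<phi>" by (rule square_integrable_imp_integrable[OF \<phi>]) (erule supp)
  define m where "m k = inv_ft (\<lambda>\<omega>. (\<i> * of_real \<omega>) ^ k * \<phi> \<omega>) 0" for k
  have comb: "(\<Sum>k\<le>n. of_real (chromatic_coeff n k) * (m k - of_real ((deriv ^^ k) f 0))) = 0" for n
  proof -
    have "(\<Sum>k\<le>n. of_real (chromatic_coeff n k) * m k) = \<i> ^ n / of_real (sqrt (2 * pi)) * c n"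
      using chromatic_combination_inv_ft[OF int supp, of n 0]
      by (simp add: m_def degree_legendre_pi coeff)
    also have "\<dots> = of_real (chromatic_deriv n f 0)"
      by (simp add: c_def flip: power_mult_distrib)
    also have "\<dots> = (\<Sum>k\<le>n. of_real (chromatic_coeff n k) * complex_of_real ((deriv ^^ k) f 0))"
      by (simp add: chromatic_deriv_def degree_legendre_pi)
    finally show ?thesis by (simp add: right_diff_distrib sum_subtractf)
  qed
  have m: "m k = of_real ((deriv ^^ k) f 0)" for k
  proof (induction k rule: less_induct)
    case (less k)
    have "(\<Sum>j\<le>k. of_real (chromatic_coeff k j) * (m j - of_real ((deriv ^^ j) f 0)))
        = of_real (chromatic_coeff k k) * (m k - of_real ((deriv ^^ k) f 0))"
      by (subst sum.remove[of _ k]) (auto intro!: sum.neutral simp: less)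
    then show ?case using comb[of k] chromatic_coeff_top_nonzero[of k] by simp
  qed
  have "of_real (f t) = inv_ft \<phi> t" for t
  proof -
    have "(\<lambda>k. (deriv ^^ k) F 0 / fact k * (of_real t - 0) ^ k) sums F (of_real t)"
      by (rule holomorphic_power_series[where r = "\<bar>t\<bar> + 1"])
        (use F in \<open>auto intro: holomorphic_on_subset simp: dist_norm\<close>)
    moreover have "(deriv ^^ k) F 0 = m k" for k
      using real_restriction_higher_deriv(1)[OF F eq, of k 0] m[of k] by simp
    ultimately have "(\<lambda>k. m k / fact k * of_real t ^ k) sums of_real (f t)"
      by (simp add: eq)
    moreover have "(\<lambda>k. m k / fact k * of_real t ^ k) sums inv_ft \<phi> t"
      unfolding m_def by (rule inv_ft_power_series[OF int]) (erule supp)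
    ultimately show ?thesis by (rule sums_unique2)
  qed
  then show ?thesis using \<phi> supp by blast
qed

theorem proposition1p2:
  fixes f :: "real \<Rightarrow> real" and F :: "complex \<Rightarrow> complex"
  assumes "F holomorphic_on UNIV"
    and "\<And>t::real. F (complex_of_real t) = complex_of_real (f t)"
  shows "(summable (\<lambda>n. (chromatic_deriv n f 0)\<^sup>2) \<longleftrightarrow>
          (\<forall>t. summable (\<lambda>n. (chromatic_deriv n f t)\<^sup>2)) \<and>
          (\<exists>c. \<forall>t. (\<Sum>n. (chromatic_deriv n f t)\<^sup>2) = c)) \<and>
         ((\<forall>t. summable (\<lambda>n. (chromatic_deriv n f t)\<^sup>2)) \<and>
          (\<exists>c. \<forall>t. (\<Sum>n. (chromatic_deriv n f t)\<^sup>2) = c) \<longleftrightarrow>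
          f \<in> BL pi)"
proof -
  let ?summable_0 = "summable (\<lambda>n. (chromatic_deriv n f 0)\<^sup>2)"
  let ?constant = "(\<forall>t. summable (\<lambda>n. (chromatic_deriv n f t)\<^sup>2)) \<and>
    (\<exists>c. \<forall>t. (\<Sum>n. (chromatic_deriv n f t)\<^sup>2) = c)"
  have cycle: "(S \<longleftrightarrow> C) \<and> (C \<longleftrightarrow> B)" if "S \<Longrightarrow> B" "B \<Longrightarrow> C" "C \<Longrightarrow> S" for S B C
    using that by blast
  show ?thesis
  proof (rule cycle)
    assume s: ?summable_0
    obtain \<phi> where \<phi>: "square_integrable \<phi>" "\<And>\<omega>. \<omega> \<notin> {-pi..pi} \<Longrightarrow> \<phi> \<omega> = 0"
      "\<And>t. of_real (f t) = inv_ft \<phi> t"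
      using summable_imp_inv_ft[OF assms s] by blast
    have "isCont f t" for t
      using real_restriction_higher_deriv(2)[OF assms, of 0 t] by (auto intro: DERIV_isCont)
    then have "continuous_on UNIV f" by (simp add: continuous_at_imp_continuous_on)
    then show "f \<in> BL pi"
      by (rule inv_ft_imp_BL[OF _ \<phi>(1) _ \<phi>(3)]) (erule \<phi>(2))
  next
    assume f: "f \<in> BL pi"
    obtain \<phi> where \<phi>: "square_integrable \<phi>" "\<And>\<omega>. \<omega> \<notin> {-pi..pi} \<Longrightarrow> \<phi> \<omega> = 0"
      "\<And>t. of_real (f t) = inv_ft \<phi> t"
      using BL_imp_inv_ft[OF f] by blast
    have "(\<lambda>n. (chromatic_deriv n f t)\<^sup>2) sums (l2_norm_sq \<phi> / (2 * pi))" for t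
      by (rule chromatic_energy[OF assms \<phi>(1) _ \<phi>(3)]) (erule \<phi>(2))
    then have "summable (\<lambda>n. (chromatic_deriv n f t)\<^sup>2) \<and>
        (\<Sum>n. (chromatic_deriv n f t)\<^sup>2) = l2_norm_sq \<phi> / (2 * pi)" for t
      by (simp only: sums_iff)
    then show ?constant by blast
  next
    assume ?constant
    then show ?summable_0 by (rule conjunct1[THEN spec])
  qed
qed

end
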